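(* Let $s\ge1$. Then: 1. $L(1,s,z)=\log_z(\sigma_s)$ in $K[t_1,\dots,t_s][[z]]$; 2. $L(1,s,z).(X_1\cdots X_sZ)=l(X_1\cdots X_s,Z)=\log_C(\mathbb S_s)$ in $K[X_1,\dots,X_s][[Z]]$; 3. $\sigma_s.(X_1\cdots X_sZ)=\mathbb S_s$ and $\sigma_s\in A[t_1,\dots,t_s,z]$.
   Context: $\mathbb F_q$ is a finite field with $q$ elements, $A=\mathbb F_q[\theta]$, $K=\mathbb F_q(\theta)$, $A_+$ (resp. $A_{+,d}$) is the set of monic elements (resp. monic of degree $d$). Carlitz module: $C_\theta(X)=\theta X+X^q$, extended to an $\mathbb F_q$-algebra morphism $a\mapsto C_a$ into $\mathbb F_q$-linear polynomials over $A$ under composition. $D_0=1$, $D_i=(\theta^{q^i}-\theta)D_{i-1}^q$; $l_0=1$, $l_i=(\theta-\theta^{q^i})l_{i-1}$. On $Z K[X_1,\dots,X_s][[Z]]$: $\exp_C(G)=\sum_{i\ge0}G^{q^i}/D_i$ and $\log_C(G)=\sum_{i\ge0}G^{q^i}/l_i$. Put $$l(X_1\cdots X_s,Z)=\sum_{d\ge0}Z^{q^d}\sum_{a\in A_{+,d}}\frac{C_a(X_1)\cdots C_a(X_s)}{a},\qquad \mathbb S_s=\mathbb S_s(X_1,\dots,X_s,Z)=\exp_C(l(X_1\cdots X_s,Z)).$$ On $K[t_1,\dots,t_s][[z]]$: $\varphi$ raises the coefficients in $K$ to the $q$-th power (fixing $t_1,\dots,t_s,z$), $\tau_z(f)=z(t_1-\theta)\cdots(t_s-\theta)\varphi(f)$,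 $\exp_z=\sum_{j\ge0}\frac1{D_j}\tau_z^j$, $\log_z=\sum_{j\ge0}\frac1{l_j}\tau_z^j$. With $a(t_i)$ the polynomial obtained from $a\in A$ by substituting $t_i$ for $\theta$, $$L(1,s,z)=\sum_{d\ge0}z^d\sum_{a\in A_{+,d}}\frac{a(t_1)\cdots a(t_s)}{a},\qquad \sigma_s=\sigma_s(t_1,\dots,t_s,z)=\exp_z(L(1,s,z)).$$ The ring $K[t_1,\dots,t_s][[z]]$ acts $K$-linearly on $K[X_1,\dots,X_s][[Z]]$: $t_j.F$ is obtained from $F$ by replacing $X_j$ by $C_\theta(X_j)$, and $\big(\sum_k f_kz^k\big).\big(\sum_nF_nZ^n\big)=\sum_{k,n}(f_k.F_n)Z^{nq^k}$ for $f_k\in K[t_1,\dots,t_s]$, $F_n\in K[X_1,\dots,X_s]$. *)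

theory Defs
  imports
    "HOL-Library.Poly_Mapping"
    "HOL-Library.Cardinality"
    "HOL-Computational_Algebra.Computational_Algebra"
begin

text \<open>
  The finite field with \<open>q\<close> elements is a type \<open>'a :: finite_field\<close> with \<open>q = CARD('a)\<close>;
  \<open>A\<close> is \<open>'a poly\<close> and \<open>K\<close> is \<open>'a poly fract\<close>.  The number of variables is \<open>s = CARD('n)\<close>
  for a finite index type \<open>'n\<close>.  Both \<open>K[t\<^sub>1,\<dots>,t\<^sub>s]\<close> and \<open>K[X\<^sub>1,\<dots>,X\<^sub>s]\<close> are the type
  \<open>('n, 'a) mpol\<close>, and both \<open>K[t\<^sub>1,\<dots>,t\<^sub>s][[z]]\<close> and \<open>K[X\<^sub>1,\<dots>,X\<^sub>s][[Z]]\<close> are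
  \<open>('n, 'a) mpol fps\<close>.
\<close>

type_synonym ('n, 'a) mpol = "('n \<Rightarrow>\<^sub>0 nat) \<Rightarrow>\<^sub>0 'a poly fract"

definition mconst :: "'a::finite_field poly fract \<Rightarrow> ('n, 'a) mpol" where
  "mconst c = Poly_Mapping.single 0 c"

definition mvar :: "'n \<Rightarrow> ('n, 'a::finite_field) mpol" where
  "mvar j = Poly_Mapping.single (Poly_Mapping.single j 1) 1"


subsection \<open>The Carlitz module\<close>

definition theta :: "'a::finite_field poly" where
  "theta = [:0, 1:]"

definition carlitz_theta :: "'a::finite_field poly poly" where
  "carlitz_theta = [:0, theta:] + monom 1 CARD('a)"

text \<open>
  The algebra morphism sends \<open>a = \<Sum>i. c\<^sub>i \<theta>\<^sup>i\<close> to the sum of the \<open>c\<^sub>i\<close>-multiples of the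
  \<open>i\<close>-fold composites of \<open>C\<^sub>\<theta>\<close>.
\<close>

definition carlitz :: "'a::finite_field poly \<Rightarrow> 'a poly poly" where
  "carlitz a = (\<Sum>i\<le>degree a. smult [:coeff a i:] ((pcompose carlitz_theta ^^ i) [:0, 1:]))"

definition eval_A :: "'a::finite_field poly poly \<Rightarrow> ('n, 'a) mpol \<Rightarrow> ('n, 'a) mpol" where
  "eval_A P x = poly (map_poly (\<lambda>b. mconst (to_fract b)) P) x"

primrec carlitz_D :: "nat \<Rightarrow> 'a::finite_field poly" where
  "carlitz_D 0 = 1"
| "carlitz_D (Suc i) = (theta ^ (CARD('a) ^ Suc i) - theta) * carlitz_D i ^ CARD('a)"

primrec carlitz_l :: "nat \<Rightarrow> 'a::finite_field poly" where
  "carlitz_l 0 = 1"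
| "carlitz_l (Suc i) = (theta - theta ^ (CARD('a) ^ Suc i)) * carlitz_l i"

definition monic_deg :: "nat \<Rightarrow> 'a::finite_field poly set" where
  "monic_deg d = {a. lead_coeff a = 1 \<and> degree a = d}"


subsection \<open>Series in \<open>Z\<close>\<close>

text \<open>
  All infinite sums are sums in the library topology on formal power series, which is the
  \<open>Z\<close>-adic one (resp. \<open>z\<close>-adic).  The next two series converge for \<open>G\<close> without constant term.
\<close>

definition exp_C :: "('n, 'a::finite_field) mpol fps \<Rightarrow> ('n, 'a) mpol fps" where
  "exp_C G = suminf (\<lambda>i. fps_const (mconst (1 / to_fract (carlitz_D i))) * G ^ (CARD('a) ^ i))"

definition log_C :: "('n, 'a::finite_field) mpol fps \<Rightarrow> ('n, 'a) mpol fps" where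
  "log_C G = suminf (\<lambda>i. fps_const (mconst (1 / to_fract (carlitz_l i))) * G ^ (CARD('a) ^ i))"

definition l_series :: "('n::finite, 'a::finite_field) mpol fps" where
  "l_series = suminf (\<lambda>d. fps_X ^ (CARD('a) ^ d) *
     fps_const (\<Sum>a\<in>monic_deg d.
       mconst (1 / to_fract a) * (\<Prod>j\<in>UNIV. eval_A (carlitz a) (mvar j))))"

definition SS :: "('n::finite, 'a::finite_field) mpol fps" where
  "SS = exp_C l_series"


subsection \<open>Series in \<open>z\<close>\<close>

definition frob :: "('n, 'a::finite_field) mpol fps \<Rightarrow> ('n, 'a) mpol fps" where
  "frob f = Abs_fps (\<lambda>k. Poly_Mapping.map (\<lambda>c. c ^ CARD('a)) (fps_nth f k))"

definition tau_z :: "('n::finite, 'a::finite_field) mpol fps \<Rightarrow> ('n, 'a) mpol fps" where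
  "tau_z f = fps_X * fps_const (\<Prod>j\<in>UNIV. mvar j - mconst (to_fract theta)) * frob f"

definition exp_z :: "('n::finite, 'a::finite_field) mpol fps \<Rightarrow> ('n, 'a) mpol fps" where
  "exp_z f = suminf (\<lambda>j. fps_const (mconst (1 / to_fract (carlitz_D j))) * (tau_z ^^ j) f)"

definition log_z :: "('n::finite, 'a::finite_field) mpol fps \<Rightarrow> ('n, 'a) mpol fps" where
  "log_z f = suminf (\<lambda>j. fps_const (mconst (1 / to_fract (carlitz_l j))) * (tau_z ^^ j) f)"

text \<open>\<open>a(t\<^sub>j)\<close>: the coefficients lie in the finite field, so only the variable is replaced.\<close>

definition at_var :: "'a::finite_field poly \<Rightarrow> 'n \<Rightarrow> ('n, 'a) mpol" where
  "at_var a j = poly (map_poly (\<lambda>c. mconst (to_fract [:c:])) a) (mvar j)"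

definition L_series :: "('n::finite, 'a::finite_field) mpol fps" where
  "L_series = suminf (\<lambda>d. fps_X ^ d *
     fps_const (\<Sum>a\<in>monic_deg d. mconst (1 / to_fract a) * (\<Prod>j\<in>UNIV. at_var a j)))"

definition sigma :: "('n::finite, 'a::finite_field) mpol fps" where
  "sigma = exp_z L_series"

text \<open>The subring \<open>A[t\<^sub>1,\<dots>,t\<^sub>s,z]\<close> of \<open>K[t\<^sub>1,\<dots>,t\<^sub>s][[z]]\<close>.\<close>

definition A_t_z :: "('n, 'a::finite_field) mpol fps set" where
  "A_t_z = range (\<lambda>P :: (('n \<Rightarrow>\<^sub>0 nat) \<Rightarrow>\<^sub>0 'a poly) poly.
     fps_of_poly (map_poly (Poly_Mapping.map to_fract) P))"


subsection \<open>The action\<close>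

definition msubst :: "('n::finite \<Rightarrow> ('n, 'a::finite_field) mpol) \<Rightarrow> ('n, 'a) mpol \<Rightarrow> ('n, 'a) mpol"
  where "msubst g F =
    (\<Sum>m\<in>Poly_Mapping.keys F. mconst (Poly_Mapping.lookup F m) *
       (\<Prod>j\<in>UNIV. g j ^ Poly_Mapping.lookup m j))"

text \<open>
  A monomial \<open>t\<^sub>1\<^bsup>m\<^sub>1\<^esup> \<cdots> t\<^sub>s\<^bsup>m\<^sub>s\<^esup>\<close> substitutes, for every \<open>j\<close>, the \<open>m\<^sub>j\<close>-fold iterate of \<open>C\<^sub>\<theta>\<close>
  at \<open>X\<^sub>j\<close> for \<open>X\<^sub>j\<close>.
\<close>

definition mono_act :: "('n::finite \<Rightarrow>\<^sub>0 nat) \<Rightarrow> ('n, 'a::finite_field) mpol \<Rightarrow> ('n, 'a) mpol" where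
  "mono_act m = msubst (\<lambda>j. (eval_A carlitz_theta ^^ Poly_Mapping.lookup m j) (mvar j))"

definition mact :: "('n::finite, 'a::finite_field) mpol \<Rightarrow> ('n, 'a) mpol \<Rightarrow> ('n, 'a) mpol" where
  "mact f F = (\<Sum>m\<in>Poly_Mapping.keys f. mconst (Poly_Mapping.lookup f m) * mono_act m F)"

text \<open>
  The coefficient of \<open>Z\<^sup>N\<close> collects the pairs \<open>(k, n)\<close> with \<open>n q\<^sup>k = N\<close>.  For \<open>N > 0\<close> these are
  finitely many; for \<open>N = 0\<close> the sum makes sense only if almost all of the terms with \<open>n = 0\<close>
  vanish, in particular if \<open>F\<close> has no constant term.
\<close>

definition act :: "('n::finite, 'a::finite_field) mpol fps \<Rightarrow> ('n, 'a) mpol fps \<Rightarrow> ('n, 'a) mpol fps"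
  where "act f F = Abs_fps (\<lambda>N. Sum_any (\<lambda>(k, n).
    mact (fps_nth f k) (fps_nth F n) when n * CARD('a) ^ k = N))"

definition XZ :: "('n::finite, 'a::finite_field) mpol fps" where
  "XZ = fps_const (\<Prod>j\<in>UNIV. mvar j) * fps_X"


subsection \<open>Adequacy of \<open>carlitz\<close>\<close>

text \<open>
  By \<open>carlitz_of_theta\<close>, \<open>carlitz_add\<close>, \<open>carlitz_const\<close> and \<open>carlitz_mult\<close> below, \<open>carlitz\<close> is
  the algebra morphism into polynomials under composition with value \<open>\<theta> X + X\<^sup>q\<close> at \<open>\<theta>\<close>.
\<close>

lemma pcompose_power: "pcompose (p ^ n) r = pcompose p r ^ n"
  for p r :: "'a::comm_ring_1 poly"
  by (induction n) (simp_all add: pcompose_mult pcompose_1)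

lemma pcompose_X: "pcompose p [:0, 1:] = p"
  for p :: "'a::comm_ring_1 poly"
  by (induction p) (simp_all add: pcompose_pCons)

lemma carlitz_of_theta: "carlitz theta = (carlitz_theta :: 'a::finite_field poly poly)"
  by (simp add: carlitz_def theta_def) (simp flip: one_pCons)

lemma choose_CARD_eq_0:
  assumes "0 < i" "i < CARD('a::finite_field)"
  shows "(of_nat (CARD('a) choose i) :: 'a) = 0"
proof -
  define q where "q = CARD('a)"
  have q: "q > 0" by (simp add: q_def card_gt_0_iff)
  define P :: "'a poly" where "P = (\<Sum>i\<in>{1..<q}. monom (of_nat (q choose i)) i)"
  have "poly P c = 0" for c
  proof -
    have "(c + 1) ^ q = (\<Sum>i\<le>q. of_nat (q choose i) * c ^ i)"
      by (simp add: binomial_ring)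
    also have "{..q} = insert 0 (insert q {1..<q})" using q by auto
    also have "(\<Sum>i\<in>insert 0 (insert q {1..<q}). of_nat (q choose i) * c ^ i) = 1 + (c ^ q + poly P c)"
      using q by (simp add: P_def poly_sum poly_monom)
    finally show ?thesis
      using finite_field_power_card_eq_same[of c] finite_field_power_card_eq_same[of "c + 1"]
      by (simp add: q_def)
  qed
  hence roots: "{x. poly P x = 0} = UNIV" by auto
  have "degree P < q"
    unfolding P_def using q by (intro degree_sum_less) (auto intro: le_less_trans[OF degree_monom_le])
  hence "P = 0"
    using card_poly_roots_bound[of P] roots by (auto simp: q_def)
  hence "coeff P i = 0" by simp
  thus ?thesis using assms
    by (simp add: P_def coeff_sum q_def)
qed

lemma frobenius_add:
  fixes x y :: "'a::finite_field poly poly"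
  shows "(x + y) ^ CARD('a) = x ^ CARD('a) + y ^ CARD('a)"
proof -
  define q where "q = CARD('a)"
  have q: "q > 0" by (simp add: q_def card_gt_0_iff)
  have 0: "(of_nat (q choose i) :: 'a poly poly) = 0" if "i \<in> {1..<q}" for i
    using choose_CARD_eq_0[where 'a = 'a, of i] that by (simp add: q_def of_nat_poly)
  have "(x + y) ^ q = (\<Sum>i\<le>q. of_nat (q choose i) * x ^ i * y ^ (q - i))"
    by (rule binomial_ring)
  also have "{..q} = insert 0 (insert q {1..<q})" using q by auto
  finally show ?thesis using q 0 by (simp add: q_def)
qed

lemma pcompose_ctheta_eq:
  fixes p :: "'a::finite_field poly poly"
  shows "pcompose carlitz_theta p = smult theta p + p ^ CARD('a)"
  by (simp add: carlitz_theta_def pcompose_add pcompose_pCons monom_altdef pcompose_smult pcompose_power)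

lemma pcompose_ctheta_add: "pcompose carlitz_theta (p + r) = pcompose carlitz_theta p + pcompose carlitz_theta r"
  by (simp add: pcompose_ctheta_eq frobenius_add smult_add_right)

lemma pcompose_ctheta_smult: "pcompose carlitz_theta (smult [:c:] p) = smult [:c:] (pcompose carlitz_theta p)"
  using finite_field_power_card_eq_same[of c]
  by (simp add: pcompose_ctheta_eq smult_power smult_add_right mult.commute poly_const_pow)

lemma pcompose_ctheta_0: "pcompose carlitz_theta 0 = 0"
  by (simp add: pcompose_ctheta_eq card_gt_0_iff)

lemma carlitz_superset:
  "degree a \<le> N \<Longrightarrow> carlitz a = (\<Sum>i\<le>N. smult [:coeff a i:] ((pcompose carlitz_theta ^^ i) [:0, 1:]))"
  unfolding carlitz_def by (rule sum.mono_neutral_left) (auto simp: coeff_eq_0)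

lemma carlitz_add: "carlitz (a + b) = carlitz a + carlitz b"
proof -
  define N where "N = max (degree a) (degree b)"
  have "degree a \<le> N" "degree b \<le> N" "degree (a + b) \<le> N"
    by (auto simp: N_def degree_add_le_max)
  thus ?thesis
    by (simp add: carlitz_superset flip: sum.distrib smult_add_left)
qed

lemma smult_sum_r: "smult c (sum f I) = (\<Sum>i\<in>I. smult c (f i))"
  by (induction I rule: infinite_finite_induct) (simp_all add: smult_add_right)

lemma carlitz_smult: "carlitz (smult c a) = smult [:c:] (carlitz a)"
proof -
  have "carlitz (smult c a) = (\<Sum>i\<le>degree a. smult [:coeff (smult c a) i:] ((pcompose carlitz_theta ^^ i) [:0, 1:]))"
    by (intro carlitz_superset) simp
  also have "\<dots> = smult [:c:] (carlitz a)"
    by (simp add: carlitz_def smult_sum_r mult.commute)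
  finally show ?thesis .
qed

lemma carlitz_const: "carlitz [:c:] = smult [:c:] [:0, 1:]"
  by (simp add: carlitz_def)

lemma pcompose_ctheta_sum: "pcompose carlitz_theta (sum f I) = (\<Sum>i\<in>I. pcompose carlitz_theta (f i))"
  by (induction I rule: infinite_finite_induct) (simp_all add: pcompose_ctheta_0 pcompose_ctheta_add)

lemma carlitz_pCons0: "carlitz (pCons 0 a) = pcompose carlitz_theta (carlitz a)"
proof -
  have "carlitz (pCons 0 a) = (\<Sum>i\<le>Suc (degree a). smult [:coeff (pCons 0 a) i:] ((pcompose carlitz_theta ^^ i) [:0, 1:]))"
    by (intro carlitz_superset) simp
  also have "\<dots> = pcompose carlitz_theta (carlitz a)"
    by (subst sum.atMost_Suc_shift) (simp add: carlitz_def pcompose_ctheta_sum pcompose_ctheta_smult)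
  finally show ?thesis .
qed

lemma carlitz_mult: "carlitz (a * b) = pcompose (carlitz a) (carlitz b)"
proof (induction a)
  case 0
  show ?case by (simp add: carlitz_def)
next
  case (pCons c a)
  have "pCons c a = [:c:] + pCons 0 a" by simp
  hence "carlitz (pCons c a) = smult [:c:] [:0, 1:] + pcompose carlitz_theta (carlitz a)"
    by (metis carlitz_add carlitz_const carlitz_pCons0)
  moreover have "carlitz (pCons c a * b) = smult [:c:] (carlitz b) + pcompose carlitz_theta (carlitz (a * b))"
    by (simp add: mult_pCons_left carlitz_add carlitz_smult carlitz_pCons0)
  ultimately show ?case using pCons.IH
    by (simp add: pcompose_add pcompose_smult pcompose_pCons pcompose_assoc)
qed


subsection \<open>Adequacy of the action\<close>

text \<open>
  By \<open>mact_mvar\<close>, \<open>mact_mconst\<close>, \<open>mact_mult\<close>, \<open>mact_add_left\<close> and \<open>mact_add_right\<close> below,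
  \<open>mact\<close> is the \<open>K\<close>-linear module structure in which \<open>t\<^sub>j\<close> replaces \<open>X\<^sub>j\<close> by \<open>C\<^sub>\<theta>(X\<^sub>j)\<close>.
\<close>

lemma mconst_0 [simp]: "mconst 0 = 0"
  by (simp add: mconst_def)

lemma mconst_1 [simp]: "mconst 1 = 1"
  by (simp add: mconst_def)

lemma mconst_add: "mconst (c + d) = mconst c + mconst d"
  by (simp add: mconst_def single_add)

lemma mconst_mult: "mconst (c * d) = mconst c * mconst d"
  by (simp add: mconst_def mult_single)

lemma msum_superset:
  assumes "finite M" "Poly_Mapping.keys F \<subseteq> M"
  shows "(\<Sum>m\<in>Poly_Mapping.keys F. mconst (Poly_Mapping.lookup F m) * h m)
       = (\<Sum>m\<in>M. mconst (Poly_Mapping.lookup F m) * h m)"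
  by (rule sum.mono_neutral_left) (use assms in \<open>auto simp: in_keys_iff\<close>)

lemma msum_add:
  "(\<Sum>m\<in>Poly_Mapping.keys (F + G). mconst (Poly_Mapping.lookup (F + G) m) * h m)
   = (\<Sum>m\<in>Poly_Mapping.keys F. mconst (Poly_Mapping.lookup F m) * h m)
   + (\<Sum>m\<in>Poly_Mapping.keys G. mconst (Poly_Mapping.lookup G m) * h m)"
proof -
  define M where "M = Poly_Mapping.keys F \<union> Poly_Mapping.keys G"
  have M: "finite M" "Poly_Mapping.keys F \<subseteq> M" "Poly_Mapping.keys G \<subseteq> M"
    "Poly_Mapping.keys (F + G) \<subseteq> M"
    using keys_add[of F G] by (auto simp: M_def)
  show ?thesis
    unfolding msum_superset[OF M(1) M(2)] msum_superset[OF M(1) M(3)] msum_superset[OF M(1) M(4)]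
    by (simp add: lookup_add mconst_add distrib_right sum.distrib)
qed

lemma msum_single:
  "(\<Sum>m\<in>Poly_Mapping.keys (Poly_Mapping.single k c).
      mconst (Poly_Mapping.lookup (Poly_Mapping.single k c) m) * h m) = mconst c * h k"
  by auto

lemma mpol_induct [case_names single add]:
  fixes F :: "('n, 'a::finite_field) mpol"
  assumes "\<And>k c. P (Poly_Mapping.single k c)" "\<And>F G. P F \<Longrightarrow> P G \<Longrightarrow> P (F + G)"
  shows "P F"
proof (induction F rule: Poly_Mapping.update_induct)
  case const
  show ?case using assms(1)[of 0 0] by simp
next
  case (update f a b)
  have "Poly_Mapping.update a b f = Poly_Mapping.single a b + f"
    using update by (intro poly_mapping_eqI)
      (auto simp: lookup_update lookup_add lookup_single when_def in_keys_iff)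
  thus ?case using assms update by metis
qed

lemma msubst_add: "msubst g (F + G) = msubst g F + msubst g G"
  unfolding msubst_def by (rule msum_add)

lemma msubst_single:
  "msubst g (Poly_Mapping.single m c) = mconst c * (\<Prod>j\<in>UNIV. g j ^ Poly_Mapping.lookup m j)"
  unfolding msubst_def by (rule msum_single)

lemma msubst_mult: "msubst g (F * G) = msubst g F * msubst g G"
proof (induction F rule: mpol_induct)
  case (single k c)
  show ?case
    by (induction G rule: mpol_induct)
      (simp_all add: mult_single msubst_single mconst_mult lookup_add power_add prod.distrib
        algebra_simps msubst_add)
qed (simp_all add: distrib_right msubst_add)

lemma msubst_mconst [simp]: "msubst g (mconst c) = mconst c"
  using msubst_single[of g 0 c] by (simp add: mconst_def)

lemma msubst_mvar [simp]: "msubst g (mvar j) = g j"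
proof -
  have "(\<Prod>i\<in>UNIV. g i ^ Poly_Mapping.lookup (Poly_Mapping.single j 1) i)
      = (\<Prod>i\<in>UNIV. if i = j then g i else 1)"
    by (intro prod.cong) (auto simp: lookup_single when_def)
  thus ?thesis
    by (simp add: mvar_def msubst_single)
qed

lemma msubst_1 [simp]: "msubst g 1 = 1"
  by (metis mconst_1 msubst_mconst)

lemma msubst_power: "msubst g (F ^ k) = msubst g F ^ k"
  by (induction k) (auto simp: msubst_mult msubst_1)

lemma msubst_0: "msubst g 0 = 0"
  by (simp add: msubst_def)

lemma msubst_prod: "msubst g (prod h I) = (\<Prod>i\<in>I. msubst g (h i))"
  by (induction I rule: infinite_finite_induct)
    (auto simp: msubst_mult msubst_1)

lemma msubst_msubst: "msubst g (msubst h F) = msubst (\<lambda>j. msubst g (h j)) F"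
  by (induction F rule: mpol_induct)
    (simp_all add: msubst_add msubst_single msubst_mult msubst_prod msubst_power)

lemma msubst_mvar_id: "msubst mvar F = F"
proof (induction F rule: mpol_induct)
  case (single k c)
  have *: "(mvar j :: ('a,'b) mpol) ^ n = Poly_Mapping.single (Poly_Mapping.single j n) 1" for j n
    by (induction n) (auto simp: mvar_def mult_single single_add[symmetric])
  have **: "(\<Prod>j\<in>I. (Poly_Mapping.single (h j) 1 :: ('a,'b) mpol))
      = Poly_Mapping.single (\<Sum>j\<in>I. h j) 1" for I h
    by (induction I rule: infinite_finite_induct) (auto simp: mult_single)
  have "(\<Sum>j\<in>UNIV. Poly_Mapping.single j (Poly_Mapping.lookup k j)) = k"
    by (intro poly_mapping_eqI) (auto simp: lookup_sum lookup_single when_def)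
  thus ?case
    by (simp add: msubst_single * ** mconst_def mult_single)
qed (simp add: msubst_add)

lemma msubst_eval_A: "msubst g (eval_A P x) = eval_A P (msubst g x)"
  by (induction P)
    (auto simp: eval_A_def map_poly_pCons msubst_add msubst_mult msubst_0)

lemma msubst_eval_A_iter: "msubst g ((eval_A P ^^ k) x) = (eval_A P ^^ k) (msubst g x)"
  by (induction k) (auto simp: msubst_eval_A)

lemma mono_act_add: "mono_act (m + m') F = mono_act m (mono_act m' F)"
  by (simp add: mono_act_def msubst_msubst msubst_eval_A_iter lookup_add add.commute[of "Poly_Mapping.lookup m _"] funpow_add)

lemma mono_act_plus: "mono_act m (F + G) = mono_act m F + mono_act m G"
  by (simp add: mono_act_def msubst_add)

lemma mono_act_scale: "mono_act m (mconst c * F) = mconst c * mono_act m F"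
  by (simp add: mono_act_def msubst_mult)

lemma mact_single: "mact (Poly_Mapping.single m c) F = mconst c * mono_act m F"
  unfolding mact_def by (rule msum_single)

lemma mact_add_left: "mact (f + g) F = mact f F + mact g F"
  unfolding mact_def by (rule msum_add)

lemma mact_add_right: "mact f (F + G) = mact f F + mact f G"
  by (simp add: mact_def mono_act_plus sum.distrib algebra_simps)

lemma mact_mvar:
  fixes F :: "('n::finite, 'a::finite_field) mpol"
  shows "mact (mvar j) F = msubst (mvar(j := eval_A carlitz_theta (mvar j))) F"
proof -
  have "(\<lambda>i. (eval_A carlitz_theta ^^ Poly_Mapping.lookup (Poly_Mapping.single j 1) i) (mvar i))
      = (mvar(j := eval_A carlitz_theta (mvar j)) :: 'n \<Rightarrow> ('n, 'a) mpol)"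
    by (auto simp: lookup_single when_def)
  thus ?thesis
    by (subst (1) mvar_def) (simp only: mact_single mono_act_def mconst_1 mult_1_left)
qed

lemma mact_mconst: "mact (mconst c) F = mconst c * F"
  using mact_single[of 0 c F] by (simp add: mconst_def mono_act_def msubst_mvar_id)

lemma mact_mult: "mact (f * g) F = mact f (mact g F)"
proof (induction f rule: mpol_induct)
  case (single k c)
  show ?case
    by (induction g rule: mpol_induct)
      (simp_all add: mult_single mact_single mono_act_add mconst_mult mono_act_scale
        mono_act_plus mact_add_left distrib_left mult.assoc)
qed (simp_all add: distrib_right mact_add_left)

end

theory Submission
  imports Defs
begin

text \<open>
  Write \<open>q\<close> for the number of elements of the field, \<open>\<phi>\<close> for the \<open>q\<close>-th power on coefficients,
  \<open>b\<^sub>k(T)\<close> for the product of the \<open>T - \<theta>\<^bsup>q^i\<^esup>\<close> with \<open>i < k\<close>, \<open>B\<^sub>k\<close> for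
  \<open>b\<^sub>k(t\<^sub>1) \<cdots> b\<^sub>k(t\<^sub>s)\<close>, and \<open>S\<^sub>d\<close> for the coefficient of \<open>z\<^sup>d\<close> in \<open>L(1,s,z)\<close>.  The
  \<open>k\<close>-th iterate of \<open>\<tau>\<^sub>z\<close> multiplies by \<open>z\<^sup>k B\<^sub>k\<close> after applying \<open>\<phi>\<^sup>k\<close> to the coefficients, so
  the coefficient of \<open>z\<^sup>n\<close> in \<open>\<sigma>\<^sub>s\<close> is \<open>\<sigma>\<^sub>s\<^sub>,\<^sub>n = \<Sum>\<^sub>k D\<^sub>k\<^sup>-\<^sup>1 B\<^sub>k \<phi>\<^sup>k(S\<^sub>n\<^sub>-\<^sub>k)\<close>, a finite
  sum (\<open>sigma_nth\<close>).

  The identities are formal.  Comparing coefficients, \<open>log\<^sub>z\<close> inverts \<open>exp\<^sub>z\<close> because the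
  power series \<open>\<Sum> X\<^bsup>q^i\<^esup>/l\<^sub>i\<close> and \<open>\<Sum> X\<^bsup>q^i\<^esup>/D\<^sub>i\<close> are inverse under composition
  (\<open>log_exp_coeff\<close>, \<open>log_z_exp_z\<close>).  Acting on \<open>X\<^sub>1 \<cdots> X\<^sub>s Z\<close> turns \<open>\<Sum> f\<^sub>k z\<^sup>k\<close> into
  \<open>\<Sum> (f\<^sub>k . X\<^sub>1 \<cdots> X\<^sub>s) Z\<^bsup>q^k\<^esup>\<close>, and it turns \<open>\<tau>\<^sub>z\<close> into the \<open>q\<close>-th power: if \<open>y\<close> is
  an iterate of \<open>C\<^sub>\<theta>\<close> at \<open>X\<^sub>j\<close>, then \<open>(t\<^sub>j - \<theta>) . y = C\<^sub>\<theta>(y) - \<theta> y = y\<^sup>q\<close> (\<open>act_vars_twist\<close>,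
  \<open>act_tau_z\<close>).  So it carries \<open>exp\<^sub>z\<close> to \<open>exp\<^sub>C\<close> and \<open>log\<^sub>z\<close> to \<open>log\<^sub>C\<close>
  (\<open>act_twisted_series\<close>), and \<open>L(1,s,z)\<close> to \<open>l(X\<^sub>1 \<cdots> X\<^sub>s, Z)\<close> because \<open>a(t\<^sub>j)\<close> sends \<open>X\<^sub>j\<close> to
  \<open>C\<^sub>a(X\<^sub>j)\<close> (\<open>act_L_series\<close>).

  The arithmetic claim is that \<open>\<sigma>\<^sub>s\<close> is a polynomial over \<open>A\<close>.  It follows from two facts: every
  \<open>\<sigma>\<^sub>s\<^sub>,\<^sub>n\<close> has coefficients in \<open>A\<close>, and for \<open>n \<ge> s\<close> these coefficients have negative degree
  in \<open>\<theta>\<close>.  Then they vanish for \<open>n \<ge> s\<close>.  The degree is read off from the finite sum: the \<open>k\<close>-th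
  term has degree at most \<open>s (1 + q + \<cdots> + q\<^bsup>k-1\<^esup>) - n q\<^sup>k < 0\<close> (\<open>coeffs_deg_sigma\<close>).

  Integrality is proved at one monic prime \<open>P\<close> of degree \<open>d\<close> at a time (\<open>sigma_integral\<close>).
  Expand \<open>P(T) = \<Sum> c\<^sub>k b\<^sub>k(T)\<close> with \<open>c\<^sub>k\<close> in \<open>A\<close>; the \<open>c\<^sub>k\<close> are the coefficients of the Carlitz
  polynomial \<open>C\<^sub>P\<close>, and the values at \<open>T = \<theta>\<^bsup>q^m\<^esup>\<close> say that \<open>\<Sum> c\<^sub>k \<tau>\<^sub>z\<^sup>k\<close> composed with
  \<open>exp\<^sub>z\<close> is \<open>exp\<^sub>z\<close> composed with multiplication by \<open>P\<close>.  Splitting off the Euler factor of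
  \<open>L(1,s,z)\<close> at \<open>P\<close>, that is, the \<open>a\<close> divisible by \<open>P\<close>, gives
  \<open>\<Sum> c\<^sub>k \<tau>\<^sub>z\<^sup>k \<sigma>\<^sub>s - z\<^sup>d P(t\<^sub>1) \<cdots> P(t\<^sub>s) \<sigma>\<^sub>s = exp\<^sub>z(P L')\<close>, where \<open>L'\<close> is the part of
  \<open>L(1,s,z)\<close> with \<open>a\<close> prime to \<open>P\<close> (\<open>carlitz_P_sigma_eq\<close>).  The right side is divisible by \<open>P\<close>,
  since \<open>P\<^bsup>q^m\<^esup>/D\<^sub>m\<close> is (\<open>power_over_carlitz_D\<close>).  On the left side, \<open>c\<^sub>0 = P\<close>, the other \<open>c\<^sub>k\<close>
  with \<open>k < d\<close> are divisible by \<open>P\<close>, and modulo \<open>P\<close> both \<open>b\<^sub>d(T)\<close> is \<open>P(T)\<close> and \<open>\<phi>\<^sup>d\<close> is the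
  identity.  So if \<open>\<sigma>\<^sub>s\<^sub>,\<^sub>m\<close> is \<open>P\<close>-integral for all \<open>m < n\<close>, then the coefficient of \<open>z\<^sup>n\<close> shows
  that \<open>P \<sigma>\<^sub>s\<^sub>,\<^sub>n\<close> is divisible by \<open>P\<close>.
\<close>

section \<open>Powers with exponent a power of the field size\<close>

text \<open>
  The four rings of the development (\<open>A\<close>, \<open>K\<close>, polynomials and power series) are reached by the
  single hypothesis that the characteristic of the field vanishes in them.
\<close>

lemma power_card_add:
  fixes x y :: "'r::comm_ring_1"
  assumes "of_nat CHAR('a::finite_field) = (0::'r)"
  shows "(x + y) ^ (CARD('a) ^ j) = x ^ (CARD('a) ^ j) + y ^ (CARD('a) ^ j)"
proof -
  define q where "q = CARD('a)"
  have q: "q > 0" by (simp add: q_def card_gt_0_iff)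
  have step: "(u + v) ^ q = u ^ q + v ^ q" for u v :: 'r
  proof -
    have 0: "(of_nat (q choose i) :: 'r) = 0" if "i \<in> {1..<q}" for i
    proof -
      have "CHAR('a) dvd (q choose i)"
        using choose_CARD_eq_0[where 'a = 'a, of i] that by (simp add: q_def of_nat_eq_0_iff_char_dvd)
      thus ?thesis by (auto simp: assms elim!: dvdE)
    qed
    have "(u + v) ^ q = (\<Sum>i\<le>q. of_nat (q choose i) * u ^ i * v ^ (q - i))"
      by (rule binomial_ring)
    also have "{..q} = insert 0 (insert q {1..<q})" using q by auto
    finally show ?thesis using q 0 by simp
  qed
  show ?thesis unfolding q_def[symmetric]
    by (induction j) (simp_all add: mult.commute[of q] power_mult step)
qed

lemma power_card_sum:
  fixes f :: "'i \<Rightarrow> 'r::comm_ring_1"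
  assumes "of_nat CHAR('a::finite_field) = (0::'r)"
  shows "(sum f I) ^ (CARD('a) ^ j) = (\<Sum>i\<in>I. f i ^ (CARD('a) ^ j))"
  by (induction I rule: infinite_finite_induct)
    (simp_all add: power_card_add[where 'a = 'a, OF assms] power_0_left)

lemma power_card_diff:
  fixes x y :: "'r::comm_ring_1"
  assumes "of_nat CHAR('a::finite_field) = (0::'r)"
  shows "(x - y) ^ (CARD('a) ^ j) = x ^ (CARD('a) ^ j) - y ^ (CARD('a) ^ j)"
  using power_card_add[where 'a = 'a, OF assms, of "x - y" y j] by (simp add: algebra_simps)

lemma to_fract_of_nat: "to_fract (of_nat n) = of_nat n"
  by (induction n) simp_all

lemma to_fract_power: "to_fract (x ^ n) = to_fract x ^ n"
  by (induction n) simp_all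

lemma to_fract_sum: "to_fract (sum f I) = (\<Sum>i\<in>I. to_fract (f i))"
  by (induction I rule: infinite_finite_induct) simp_all

lemma of_nat_char_poly: "of_nat CHAR('a::finite_field) = (0::'a poly)"
  by (simp add: of_nat_poly)

lemma of_nat_char_fract: "of_nat CHAR('a::finite_field) = (0::'a poly fract)"
  by (metis of_nat_char_poly to_fract_of_nat to_fract_0)

lemma of_nat_char_mpol: "of_nat CHAR('a::finite_field) = (0::('n, 'a) mpol)"
  by (metis of_nat_char_fract single_of_nat single_zero)

lemma of_nat_char_mpol_fps: "of_nat CHAR('a::finite_field) = (0::('n, 'a) mpol fps)"
  by (metis of_nat_char_mpol fps_of_nat fps_const_0_eq_0)

lemmas power_card_add_A = power_card_add[OF of_nat_char_poly]
  and power_card_diff_A = power_card_diff[OF of_nat_char_poly]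
  and power_card_add_K = power_card_add[OF of_nat_char_fract]
  and power_card_diff_K = power_card_diff[OF of_nat_char_fract]
  and power_card_add_M = power_card_add[OF of_nat_char_mpol]
  and power_card_add_F = power_card_add[OF of_nat_char_mpol_fps]
  and power_card_sum_F = power_card_sum[OF of_nat_char_mpol_fps]

lemma card_pos: "0 < CARD('a::finite_field)"
  by (simp add: card_gt_0_iff)

lemma card_ge_2: "2 \<le> CARD('a::finite_field)"
proof -
  have "card {0, 1::'a} \<le> CARD('a)" by (intro card_mono) auto
  thus ?thesis by simp
qed

section \<open>The Frobenius on coefficients\<close>

definition coeff_frob :: "nat \<Rightarrow> ('n, 'a::finite_field) mpol \<Rightarrow> ('n, 'a) mpol" where
  "coeff_frob j = Poly_Mapping.map (\<lambda>c. c ^ (CARD('a) ^ j))"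

lemma lookup_coeff_frob:
  "Poly_Mapping.lookup (coeff_frob j F) m
    = Poly_Mapping.lookup (F :: ('n, 'a::finite_field) mpol) m ^ (CARD('a) ^ j)"
  by (simp add: coeff_frob_def Poly_Mapping.map.rep_eq when_def power_0_left card_pos)

lemma coeff_frob_0 [simp]: "coeff_frob j 0 = 0"
  by (intro poly_mapping_eqI) (simp add: lookup_coeff_frob power_0_left card_pos)

lemma coeff_frob_add: "coeff_frob j (F + G) = coeff_frob j F + coeff_frob j G"
  by (intro poly_mapping_eqI) (simp add: lookup_coeff_frob lookup_add power_card_add_K)

lemma coeff_frob_diff: "coeff_frob j (F - G) = coeff_frob j F - coeff_frob j G"
  by (intro poly_mapping_eqI) (simp add: lookup_coeff_frob lookup_minus power_card_diff_K)

lemma coeff_frob_sum: "coeff_frob j (sum f I) = (\<Sum>i\<in>I. coeff_frob j (f i))"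
  by (induction I rule: infinite_finite_induct) (simp_all add: coeff_frob_add)

lemma coeff_frob_single:
  "coeff_frob j (Poly_Mapping.single m c :: ('n, 'a::finite_field) mpol)
    = Poly_Mapping.single m (c ^ (CARD('a) ^ j))"
  by (intro poly_mapping_eqI) (simp add: lookup_coeff_frob lookup_single when_def power_0_left card_pos)

lemma coeff_frob_mult: "coeff_frob j (F * G) = coeff_frob j F * coeff_frob j G"
proof (induction F rule: mpol_induct)
  case (single k c)
  show ?case
    by (induction G rule: mpol_induct)
      (simp_all add: mult_single coeff_frob_single power_mult_distrib distrib_left coeff_frob_add)
qed (simp_all add: distrib_right coeff_frob_add)

lemma coeff_frob_mconst: "coeff_frob j (mconst c :: ('n, 'a::finite_field) mpol)
  = mconst (c ^ (CARD('a) ^ j))"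
  by (simp add: mconst_def coeff_frob_single)

lemma coeff_frob_mvar: "coeff_frob j (mvar i) = mvar i"
  by (simp add: mvar_def coeff_frob_single)

lemma coeff_frob_1 [simp]: "coeff_frob j 1 = 1"
  using coeff_frob_mconst[of j 1] by simp

lemma coeff_frob_prod: "coeff_frob j (prod f I) = (\<Prod>i\<in>I. coeff_frob j (f i))"
  by (induction I rule: infinite_finite_induct) (simp_all add: coeff_frob_mult)

lemma coeff_frob_power: "coeff_frob j (F ^ n) = coeff_frob j F ^ n"
  by (induction n) (simp_all add: coeff_frob_mult)

lemma coeff_frob_coeff_frob: "coeff_frob i (coeff_frob j F) = coeff_frob (i + j) F"
  by (intro poly_mapping_eqI) (simp add: lookup_coeff_frob power_add mult.commute flip: power_mult)

lemma coeff_frob_id [simp]: "coeff_frob 0 F = F"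
  by (intro poly_mapping_eqI) (simp add: lookup_coeff_frob)

lemma mconst_power: "mconst (c ^ n) = mconst c ^ n"
  by (induction n) (simp_all add: mconst_mult)

lemma mconst_sum: "mconst (sum f I) = (\<Sum>i\<in>I. mconst (f i))"
  by (induction I rule: infinite_finite_induct) (simp_all add: mconst_add)

lemma lookup_mconst_mult:
  "Poly_Mapping.lookup (mconst c * F) m = c * Poly_Mapping.lookup F m"
proof (induction F rule: mpol_induct)
  case (single k d)
  show ?case by (simp add: mconst_def mult_single lookup_single when_def)
qed (simp add: distrib_left lookup_add)

section \<open>Evaluation at a variable\<close>

lemma eval_A_0 [simp]: "eval_A 0 x = 0"
  by (simp add: eval_A_def)

lemma eval_A_pCons: "eval_A (pCons c p) x = mconst (to_fract c) + x * eval_A p x"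
  by (simp add: eval_A_def map_poly_pCons)

lemma eval_A_1 [simp]: "eval_A 1 x = 1"
  by (simp add: eval_A_def)

lemma eval_A_add: "eval_A (p + r) x = eval_A p x + eval_A r x"
  by (induction p r rule: poly_induct2) (simp_all add: eval_A_pCons mconst_add algebra_simps)

lemma eval_A_smult: "eval_A (smult c p) x = mconst (to_fract c) * eval_A p x"
  by (induction p) (simp_all add: eval_A_pCons mconst_mult algebra_simps)

lemma eval_A_mult: "eval_A (p * r) x = eval_A p x * eval_A r x"
  by (induction p) (simp_all add: eval_A_pCons eval_A_add eval_A_smult algebra_simps)

lemma eval_A_power: "eval_A (p ^ n) x = eval_A p x ^ n"
  by (induction n) (simp_all add: eval_A_mult)

lemma eval_A_sum: "eval_A (sum f I) x = (\<Sum>i\<in>I. eval_A (f i) x)"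
  by (induction I rule: infinite_finite_induct) (simp_all add: eval_A_add)

lemma eval_A_prod: "eval_A (prod f I) x = (\<Prod>i\<in>I. eval_A (f i) x)"
  by (induction I rule: infinite_finite_induct) (simp_all add: eval_A_mult)

lemma eval_A_pcompose: "eval_A (pcompose p r) x = eval_A p (eval_A r x)"
  by (induction p) (simp_all add: eval_A_pCons pcompose_pCons eval_A_add eval_A_mult)

text \<open>
  The polynomial \<open>a(T)\<close> in a new variable \<open>T\<close> over \<open>A\<close>: it has value \<open>a\<close> at \<open>\<theta>\<close> and value
  \<open>a(t\<^sub>j)\<close> at \<open>t\<^sub>j\<close>, so that the same polynomial can be evaluated at \<open>t\<^sub>j\<close> and at
  \<open>\<theta>\<^bsup>q^m\<^esup>\<close>.
\<close>

definition lift_coeffs :: "'a::finite_field poly \<Rightarrow> 'a poly poly" where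
  "lift_coeffs a = map_poly (\<lambda>c. [:c:]) a"

lemma lift_coeffs_0 [simp]: "lift_coeffs 0 = 0"
  by (simp add: lift_coeffs_def)

lemma lift_coeffs_pCons: "lift_coeffs (pCons c a) = pCons [:c:] (lift_coeffs a)"
  by (simp add: lift_coeffs_def map_poly_pCons)

lemma coeff_lift_coeffs: "coeff (lift_coeffs a) i = [:coeff a i:]"
  by (simp add: lift_coeffs_def coeff_map_poly)

lemma degree_lift_coeffs: "degree (lift_coeffs a) = degree a"
  by (cases "a = 0") (simp_all add: lift_coeffs_def map_poly_degree_eq)

lemma lift_coeffs_add: "lift_coeffs (a + b) = lift_coeffs a + lift_coeffs b"
  by (intro poly_eqI) (simp add: coeff_lift_coeffs)

lemma lift_coeffs_smult: "lift_coeffs (smult c a) = smult [:c:] (lift_coeffs a)"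
  by (intro poly_eqI) (simp add: coeff_lift_coeffs mult.commute)

lemma lift_coeffs_mult: "lift_coeffs (a * b) = lift_coeffs a * lift_coeffs b"
  by (induction a) (simp_all add: lift_coeffs_pCons lift_coeffs_add lift_coeffs_smult)

lemma at_var_eq: "at_var a j = eval_A (lift_coeffs a) (mvar j)"
  by (simp add: at_var_def eval_A_def lift_coeffs_def map_poly_map_poly o_def)

lemma at_var_mult: "at_var (a * b) j = at_var a j * at_var b j"
  by (simp add: at_var_eq lift_coeffs_mult eval_A_mult)

lemma const_power_card: "[:c::'a::finite_field:] ^ (CARD('a) ^ n) = [:c:]"
  by (simp add: poly_const_pow finite_field_power_card_power_eq_same)

lemma coeff_frob_at_var: "coeff_frob n (at_var a j) = at_var a j"
  unfolding at_var_eq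
  by (induction a)
    (simp_all add: lift_coeffs_pCons eval_A_pCons coeff_frob_add coeff_frob_mult coeff_frob_mvar coeff_frob_mconst
      const_power_card flip: to_fract_power)

lemma poly_lift_coeffs_power:
  fixes x :: "'a::finite_field poly"
  shows "poly (lift_coeffs a) (x ^ (CARD('a) ^ n)) = poly (lift_coeffs a) x ^ (CARD('a) ^ n)"
  by (induction a)
    (simp_all add: lift_coeffs_pCons power_card_add_A power_mult_distrib const_power_card
      power_0_left card_pos)

lemma poly_lift_coeffs_theta: "poly (lift_coeffs a) theta = a"
  by (induction a) (simp_all add: lift_coeffs_pCons theta_def)

section \<open>Iterates of the twisted operator and coefficients of the series\<close>

text \<open>
  The Newton basis for interpolation at \<open>\<theta>, \<theta>\<^sup>q, \<theta>\<^bsup>q^2\<^esup>, \<dots>\<close>.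
\<close>

definition newton_poly :: "nat \<Rightarrow> 'a::finite_field poly poly" where
  "newton_poly k = (\<Prod>i<k. [:- (theta ^ (CARD('a) ^ i)), 1:])"

definition newton_prod :: "nat \<Rightarrow> ('n::finite, 'a::finite_field) mpol" where
  "newton_prod k = (\<Prod>v\<in>UNIV. eval_A (newton_poly k) (mvar v))"

lemma eval_A_newton_poly:
  "eval_A (newton_poly k :: 'a::finite_field poly poly) x
    = (\<Prod>i<k. x - mconst (to_fract theta ^ (CARD('a) ^ i)))"
  by (simp add: newton_poly_def eval_A_prod eval_A_pCons to_fract_power mconst_def single_uminus)

lemma newton_prod_0 [simp]: "newton_prod 0 = 1"
  by (simp add: newton_prod_def newton_poly_def)

text \<open>
  \<open>\<phi>\<^sup>i\<close> moves the node \<open>\<theta>\<^bsup>q^k\<^esup>\<close> to \<open>\<theta>\<^bsup>q^(i+k)\<^esup>\<close> and fixes the variables; the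
  equation is the composition law of the iterates of \<open>\<tau>\<^sub>z\<close>.
\<close>

lemma newton_prod_add: "newton_prod (i + j) = newton_prod i * coeff_frob i (newton_prod j)"
proof -
  have *: "(\<Prod>k<i+j. h k) = (\<Prod>k<i. h k) * (\<Prod>k<j. h (i + k))" for h :: "nat \<Rightarrow> ('a,'b) mpol"
    by (induction j) (simp_all add: mult.assoc)
  show ?thesis
    by (simp add: newton_prod_def eval_A_newton_poly
      coeff_frob_prod coeff_frob_diff coeff_frob_mvar coeff_frob_mconst * prod.distrib
      power_add mult.commute flip: power_mult)
qed

lemma tau_z_nth: "fps_nth (tau_z f) n
  = (if n = 0 then 0 else newton_prod 1 * coeff_frob 1 (fps_nth f (n - 1)))"
  by (simp add: tau_z_def frob_def coeff_frob_def newton_prod_def eval_A_newton_poly mult.assoc fps_mult_left_const_nth)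

lemma tau_z_funpow_nth:
  fixes f :: "('n::finite, 'a::finite_field) mpol fps"
  shows "fps_nth ((tau_z ^^ j) f) n = (if j \<le> n then newton_prod j * coeff_frob j (fps_nth f (n - j)) else 0)"
proof (induction j arbitrary: n)
  case (Suc j)
  have "(newton_prod (Suc j) :: ('n, 'a) mpol) = newton_prod 1 * coeff_frob 1 (newton_prod j)"
    using newton_prod_add[of 1 j] by simp
  thus ?case using Suc by (auto simp: tau_z_nth coeff_frob_mult coeff_frob_coeff_frob mult.assoc)
qed simp

lemma suminf_fps_nth:
  fixes f :: "nat \<Rightarrow> 'r::comm_ring_1 fps"
  assumes "\<And>k i. i > N k \<Longrightarrow> fps_nth (f i) k = 0"
  shows "fps_nth (suminf f) k = (\<Sum>i\<le>N k. fps_nth (f i) k)"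
proof -
  have "(\<lambda>n. \<Sum>i<n. f i) \<longlonglongrightarrow> Abs_fps (\<lambda>k. \<Sum>i\<le>N k. fps_nth (f i) k)"
  proof (rule tendsto_fpsI)
    fix k
    have "fps_nth (\<Sum>i<n. f i) k = (\<Sum>i\<le>N k. fps_nth (f i) k)" if "n > N k" for n
      unfolding fps_sum_nth using that assms[of k]
      by (intro sum.mono_neutral_right) auto
    thus "\<forall>\<^sub>F n in sequentially. fps_nth (\<Sum>i<n. f i) k
        = fps_nth (Abs_fps (\<lambda>k. \<Sum>i\<le>N k. fps_nth (f i) k)) k"
      by (auto simp: eventually_at_top_dense)
  qed
  hence "suminf f = Abs_fps (\<lambda>k. \<Sum>i\<le>N k. fps_nth (f i) k)"
    by (metis sums_def sums_unique)
  thus ?thesis by simp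
qed

lemma twisted_series_nth:
  "fps_nth (suminf (\<lambda>j. fps_const (mconst (c j)) * (tau_z ^^ j) f)) n
   = (\<Sum>j\<le>n. mconst (c j) * newton_prod j * coeff_frob j (fps_nth f (n - j)))"
  by (subst suminf_fps_nth[where N = "\<lambda>n. n"]) (auto simp: tau_z_funpow_nth mult.assoc)

lemmas exp_z_nth = twisted_series_nth[of "\<lambda>j. 1 / to_fract (carlitz_D j)", folded exp_z_def]
lemmas log_z_nth = twisted_series_nth[of "\<lambda>j. 1 / to_fract (carlitz_l j)", folded log_z_def]

definition power_sum :: "nat \<Rightarrow> ('n::finite, 'a::finite_field) mpol" where
  "power_sum d = (\<Sum>a\<in>monic_deg d. mconst (1 / to_fract a) * (\<Prod>j\<in>UNIV. at_var a j))"

lemma L_series_nth: "fps_nth L_series d = power_sum d"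
proof -
  have *: "fps_nth (fps_X ^ e * fps_const c) k = (if k = e then c else 0)" for e k and c :: "('a, 'b) mpol"
    by (auto simp: fps_X_power_mult_nth)
  define f :: "nat \<Rightarrow> ('a, 'b) mpol fps" where "f e = fps_X ^ e * fps_const (power_sum e)" for e
  have f: "fps_nth (f e) k = (if k = e then power_sum e else 0)" for e k
    unfolding f_def by (rule *)
  have "L_series = suminf f"
    by (simp add: L_series_def f_def[abs_def] power_sum_def)
  also have "fps_nth (suminf f) d = (\<Sum>e\<le>d. fps_nth (f e) d)"
    by (rule suminf_fps_nth) (simp add: f)
  finally show ?thesis by (simp add: f)
qed

lemma sigma_nth:
  "fps_nth sigma n = (\<Sum>j\<le>n. mconst (1 / to_fract (carlitz_D j)) * newton_prod j
    * coeff_frob j (power_sum (n - j)))"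
  by (simp add: sigma_def exp_z_nth L_series_nth)

lemma sum_triangle:
  fixes g :: "nat \<Rightarrow> nat \<Rightarrow> 'b::comm_monoid_add"
  shows "(\<Sum>i\<le>n. \<Sum>j\<le>n - i. g i j) = (\<Sum>m\<le>n. \<Sum>i\<le>m. g i (m - i))"
proof -
  have "(\<Sum>i\<le>n. \<Sum>j\<le>n - i. g i j) = (\<Sum>(i, j)\<in>(SIGMA i:{..n}. {..n - i}). g i j)"
    by (rule sum.Sigma) auto
  also have "(SIGMA i:{..n}. {..n - i}) = {(i, j). i + j \<le> n}" by auto
  finally show ?thesis by (simp add: sum.triangle_reindex_eq)
qed

section \<open>The logarithm inverts the exponential\<close>

lemma theta_power_neq_theta: "m > 0 \<Longrightarrow> theta ^ (CARD('a) ^ m) \<noteq> (theta :: 'a::finite_field poly)"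
proof
  assume m: "m > 0" and "theta ^ (CARD('a) ^ m) = (theta :: 'a::finite_field poly)"
  hence "degree ((theta :: 'a poly) ^ (CARD('a) ^ m)) = degree (theta :: 'a poly)" by simp
  hence "CARD('a) ^ m = 1" by (simp add: degree_power_eq theta_def)
  thus False using m card_ge_2[where 'a = 'a] by simp
qed

lemma carlitz_D_nz: "carlitz_D i \<noteq> 0"
  by (induction i) (simp_all add: theta_power_neq_theta[where m = "Suc _", simplified])

lemma carlitz_l_nz: "carlitz_l i \<noteq> 0"
  by (induction i) (simp_all add: theta_power_neq_theta[where m = "Suc _", simplified, symmetric])

text \<open>
  The left side is the \<open>n\<close>-th coefficient \<open>u\<close> of the composite of \<open>log\<^sub>C\<close> and \<open>exp\<^sub>C\<close>.  That
  composite commutes with multiplication by \<open>\<theta>\<close>, since \<open>exp\<^sub>C\<close> takes \<open>\<theta>\<close> to \<open>C\<^sub>\<theta>\<close> and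
  \<open>log\<^sub>C\<close> takes it back; hence \<open>(\<theta>\<^bsup>q^n\<^esup> - \<theta>) u = 0\<close>.  In coefficients the recursions for
  \<open>D\<close> and \<open>l\<close> make the product telescope.
\<close>

lemma log_exp_coeff:
  fixes n :: nat
  assumes "n > 0"
  shows "(\<Sum>i\<le>n. 1 / to_fract (carlitz_l i :: 'a::finite_field poly) *
     (1 / to_fract (carlitz_D (n - i))) ^ (CARD('a) ^ i)) = 0" (is "?u = 0")
proof -
  define q where "q = CARD('a)"
  define t where "t = to_fract (theta :: 'a poly)"
  define l where "l i = 1 / to_fract (carlitz_l i :: 'a poly)" for i
  define D where "D i = 1 / to_fract (carlitz_D i :: 'a poly)" for i
  have tn: "t ^ (q ^ Suc i) - t \<noteq> 0" for i
    using theta_power_neq_theta[of "Suc i", where 'a = 'a]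
    by (simp add: t_def q_def flip: to_fract_power)
  have lS: "(t - t ^ (q ^ Suc i)) * l (Suc i) = l i" for i
    using tn[of i] carlitz_l_nz[of i, where 'a = 'a]
    by (simp add: l_def t_def q_def to_fract_power field_simps)
  have DS: "(t ^ (q ^ Suc i) - t) * D (Suc i) = D i ^ q" for i
    using tn[of i] carlitz_D_nz[of i, where 'a = 'a]
    by (simp add: D_def t_def q_def to_fract_power field_simps)
  obtain m where n: "n = Suc m" using assms by (cases n) auto
  \<comment> \<open>The terms whose consecutive differences sum up to the left side times \<open>\<theta>\<^bsup>q^n\<^esup> - \<theta>\<close>.\<close>
  define g where "g i = l i * D (m - i) ^ (q ^ Suc i)" for i
  have "(t ^ (q ^ n) - t) * (l i * D (n - i) ^ (q ^ i))
     = (if i \<le> m then g i else 0) - (if i = 0 then 0 else g (i - 1))" if "i \<le> n" for i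
  proof -
    have "(t ^ (q ^ n) - t) * x = (t ^ (q ^ n) - t ^ (q ^ i)) * x + (t ^ (q ^ i) - t) * x" for x
      by (simp add: algebra_simps)
    moreover have "(t ^ (q ^ n) - t ^ (q ^ i)) * (l i * D (n - i) ^ (q ^ i)) = (if i \<le> m then g i else 0)"
    proof (cases "i \<le> m")
      case True
      have *: "n - i = Suc (m - i)" "q ^ n = q ^ Suc (m - i) * q ^ i"
        using True by (auto simp: n simp flip: power_add power_Suc)
      have "t ^ (q ^ n) - t ^ (q ^ i) = (t ^ (q ^ Suc (m - i)) - t) ^ (q ^ i)"
        by (simp only: power_card_diff_K[where 'a = 'a, folded q_def] *(2) power_mult)
      hence "(t ^ (q ^ n) - t ^ (q ^ i)) * (l i * D (n - i) ^ (q ^ i))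
         = l i * ((t ^ (q ^ Suc (m - i)) - t) * D (Suc (m - i))) ^ (q ^ i)"
        by (simp add: power_mult_distrib *(1))
      thus ?thesis using True unfolding DS by (simp add: g_def flip: power_mult)
    qed (use that n in \<open>simp add: le_Suc_eq\<close>)
    moreover have "(t ^ (q ^ i) - t) * (l i * D (n - i) ^ (q ^ i)) = - (if i = 0 then 0 else g (i - 1))"
    proof (cases i)
      case (Suc k)
      have "(t ^ (q ^ i) - t) * l i = - l k" 
        using lS[of k] by (simp add: Suc algebra_simps)
      hence "(t ^ (q ^ i) - t) * (l i * D (n - i) ^ (q ^ i)) = - l k * D (n - i) ^ (q ^ i)"
        by (metis mult.assoc)
      thus ?thesis by (simp add: Suc g_def n)
    qed simp
    ultimately show ?thesis by simp
  qed
  hence "(t ^ (q ^ n) - t) * (\<Sum>i\<le>n. l i * D (n - i) ^ (q ^ i))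
      = (\<Sum>i\<le>n. (if i \<le> m then g i else 0) - (if i = 0 then 0 else g (i - 1)))"
    unfolding sum_distrib_left by (intro sum.cong) auto
  also have "\<dots> = (\<Sum>i\<le>n. if i \<le> m then g i else 0) - (\<Sum>i\<le>n. if i = 0 then 0 else g (i - 1))"
    by (rule sum_subtractf)
  also have "(\<Sum>i\<le>n. if i \<le> m then g i else 0) = (\<Sum>i\<le>m. g i)"
    unfolding n by (auto intro: sum.cong)
  also have "(\<Sum>i\<le>n. if i = 0 then 0 else g (i - 1)) = (\<Sum>i\<le>m. g i)"
    unfolding n sum.atMost_Suc_shift by simp
  finally have "(t ^ (q ^ n) - t) * (\<Sum>i\<le>n. l i * D (n - i) ^ (q ^ i)) = 0" by simp
  thus ?thesis using tn[of m] by (simp add: n l_def D_def q_def)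
qed

lemma log_z_exp_z: "log_z (exp_z f) = f"
proof (rule fps_ext)
  fix n
  define l where "l i = 1 / to_fract (carlitz_l i :: 'b poly)" for i
  define D where "D i = 1 / to_fract (carlitz_D i :: 'b poly)" for i
  have "fps_nth (log_z (exp_z f)) n = (\<Sum>i\<le>n. \<Sum>j\<le>n - i. mconst (l i) * newton_prod i *
      coeff_frob i (mconst (D j) * newton_prod j * coeff_frob j (fps_nth f (n - i - j))))"
    unfolding log_z_nth exp_z_nth coeff_frob_sum sum_distrib_left l_def D_def ..
  also have "\<dots> = (\<Sum>i\<le>n. \<Sum>j\<le>n - i. mconst (l i * D j ^ (CARD('b) ^ i)) *
      (newton_prod (i + j) * coeff_frob (i + j) (fps_nth f (n - (i + j)))))"
    by (intro sum.cong refl)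
      (simp add: coeff_frob_mult coeff_frob_mconst coeff_frob_coeff_frob newton_prod_add mconst_mult algebra_simps)
  also have "\<dots> = (\<Sum>m\<le>n. \<Sum>i\<le>m. mconst (l i * D (m - i) ^ (CARD('b) ^ i)) *
      (newton_prod m * coeff_frob m (fps_nth f (n - m))))"
    by (subst sum_triangle) simp
  also have "\<dots> = (\<Sum>m\<le>n. mconst (\<Sum>i\<le>m. l i * D (m - i) ^ (CARD('b) ^ i)) *
      (newton_prod m * coeff_frob m (fps_nth f (n - m))))"
    by (simp add: mconst_sum sum_distrib_right)
  also have "\<dots> = (\<Sum>m\<le>n. if m = 0 then fps_nth f n else 0)"
  proof (intro sum.cong refl)
    fix m
    show "mconst (\<Sum>i\<le>m. l i * D (m - i) ^ (CARD('b) ^ i)) * (newton_prod m * coeff_frob m (fps_nth f (n - m)))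
        = (if m = 0 then fps_nth f n else 0)"
    proof (cases "m = 0")
      case False
      hence "(\<Sum>i\<le>m. l i * D (m - i) ^ (CARD('b) ^ i)) = 0"
        using log_exp_coeff[of m, where 'a = 'b] by (simp add: l_def D_def)
      thus ?thesis using False by simp
    qed (simp add: l_def D_def)
  qed
  finally show "fps_nth (log_z (exp_z f)) n = fps_nth f n" by simp
qed

section \<open>The action on the product of the variables\<close>

text \<open>
  Only the terms up to \<open>Z\<^sup>N\<close> contribute to this coefficient, which reduces the claim to the
  Frobenius on a finite sum of monomials.
\<close>

lemma fps_power_card_nth:
  fixes F :: "('n, 'a::finite_field) mpol fps"
  shows "fps_nth (F ^ (CARD('a) ^ j)) N
    = (if CARD('a) ^ j dvd N then fps_nth F (N div CARD('a) ^ j) ^ (CARD('a) ^ j) else 0)"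
proof -
  define Q where "Q = CARD('a) ^ j"
  have Q: "Q > 0" by (simp add: Q_def)
  define T where "T = (\<Sum>i\<le>N. fps_const (fps_nth F i) * fps_X ^ i)"
  have monomial: "fps_nth (fps_const c * fps_X ^ i) k = (if k = i then c else 0)"
    for i k and c :: "('n, 'a) mpol"
    by (auto simp: fps_X_power_mult_right_nth)
  have T: "fps_nth T k = (if k \<le> N then fps_nth F k else 0)" for k
    unfolding T_def fps_sum_nth monomial by simp
  define H where "H = fps_shift (Suc N) F"
  have "F = T + H * fps_X ^ Suc N"
    by (rule fps_ext) (auto simp: T H_def fps_X_power_mult_right_nth simp del: power_Suc)
  hence "F ^ Q = T ^ Q + H ^ Q * fps_X ^ (Suc N * Q)"
    unfolding Q_def by (simp only: power_card_add_F power_mult_distrib power_mult)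
  moreover have "fps_nth (H ^ Q * fps_X ^ (Suc N * Q)) N = 0"
  proof -
    have "N < Suc N * Q" using Q by (cases Q) auto
    thus ?thesis by (simp only: fps_X_power_mult_right_nth if_True)
  qed
  ultimately have "fps_nth (F ^ Q) N = fps_nth (T ^ Q) N" by simp
  also have "T ^ Q = (\<Sum>i\<le>N. fps_const (fps_nth F i ^ Q) * fps_X ^ (i * Q))"
    unfolding T_def Q_def power_card_sum_F
    by (simp add: power_mult_distrib fps_const_power flip: power_mult)
  also have "fps_nth \<dots> N = (\<Sum>i\<le>N. if N = i * Q then fps_nth F i ^ Q else 0)"
    by (simp only: fps_sum_nth monomial)
  also have "\<dots> = (if Q dvd N then fps_nth F (N div Q) ^ Q else 0)"
  proof (cases "Q dvd N")
    case True
    then obtain M where M: "N = M * Q" by (metis dvdE mult.commute)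
    hence "(\<Sum>i\<le>N. if N = i * Q then fps_nth F i ^ Q else 0) = (\<Sum>i\<le>N. if i = M then fps_nth F i ^ Q else 0)"
      using Q by (intro sum.cong) auto
    thus ?thesis using M Q by simp
  qed (auto intro!: sum.neutral)
  finally show ?thesis by (simp add: Q_def)
qed

lemma eval_A_carlitz_theta:
  "eval_A carlitz_theta x = mconst (to_fract theta) * x + (x :: ('n, 'a::finite_field) mpol) ^ CARD('a)"
  by (simp add: carlitz_theta_def eval_A_add eval_A_pCons monom_altdef eval_A_smult eval_A_power)

text \<open>
  The substitution action in one variable: \<open>\<theta>\<close> acts on the coefficients of \<open>p\<close> as a scalar and
  the variable of \<open>p\<close> acts as \<open>C\<^sub>\<theta>\<close>.
\<close>

definition carlitz_act :: "'a::finite_field poly poly \<Rightarrow> ('n, 'a) mpol \<Rightarrow> ('n, 'a) mpol" where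
  "carlitz_act p x = (\<Sum>i\<le>degree p. mconst (to_fract (coeff p i)) * (eval_A carlitz_theta ^^ i) x)"

lemma carlitz_act_superset:
  "degree p \<le> N \<Longrightarrow> carlitz_act p x = (\<Sum>i\<le>N. mconst (to_fract (coeff p i)) * (eval_A carlitz_theta ^^ i) x)"
  unfolding carlitz_act_def by (rule sum.mono_neutral_left) (auto simp: coeff_eq_0)

lemma carlitz_act_0 [simp]: "carlitz_act 0 x = 0"
  by (simp add: carlitz_act_def)

lemma carlitz_act_add: "carlitz_act (p + r) x = carlitz_act p x + carlitz_act r x"
proof -
  define N where "N = max (degree p) (degree r)"
  have "degree p \<le> N" "degree r \<le> N" "degree (p + r) \<le> N"
    by (auto simp: N_def degree_add_le_max)
  thus ?thesis
    by (simp add: carlitz_act_superset mconst_add distrib_right sum.distrib)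
qed

lemma carlitz_act_pCons: "carlitz_act (pCons c p) x
  = mconst (to_fract c) * x + carlitz_act p (eval_A carlitz_theta x)"
proof -
  have "carlitz_act (pCons c p) x
    = (\<Sum>i\<le>Suc (degree p). mconst (to_fract (coeff (pCons c p) i)) * (eval_A carlitz_theta ^^ i) x)"
    by (intro carlitz_act_superset) simp
  also have "\<dots> = mconst (to_fract c) * x + carlitz_act p (eval_A carlitz_theta x)"
    by (subst sum.atMost_Suc_shift) (simp add: carlitz_act_def funpow_swap1)
  finally show ?thesis .
qed

lemma carlitz_act_monom: "carlitz_act (monom c n) x = mconst (to_fract c) * (eval_A carlitz_theta ^^ n) x"
  by (induction n arbitrary: x) (simp_all add: monom_0 carlitz_act_pCons monom_Suc funpow_swap1)

lemma carlitz_act_lift_coeffs: "carlitz_act (lift_coeffs a) x = eval_A (carlitz a) x"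
proof -
  have "eval_A ((pcompose carlitz_theta ^^ i) [:0, 1:]) x = (eval_A carlitz_theta ^^ i) x" for i
    by (induction i) (simp_all add: eval_A_pCons eval_A_pcompose)
  thus ?thesis
    by (simp add: carlitz_act_def carlitz_def eval_A_sum eval_A_smult coeff_lift_coeffs degree_lift_coeffs)
qed

lemma msubst_sum: "msubst g (sum f I) = (\<Sum>i\<in>I. msubst g (f i))"
  by (induction I rule: infinite_finite_induct) (simp_all add: msubst_0 msubst_add)

lemma msubst_carlitz_act: "msubst g (carlitz_act p x) = carlitz_act p (msubst g x)"
  by (simp add: carlitz_act_def msubst_sum msubst_mult msubst_eval_A_iter)

lemma mact_0_left [simp]: "mact 0 F = 0"
  by (simp add: mact_def)

text \<open>
  The factor \<open>G\<close> collects the part of a product that does not involve \<open>X\<^sub>j\<close>; the polynomials in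
  the several variables \<open>t\<^sub>j\<close> can then act on \<open>X\<^sub>1 \<cdots> X\<^sub>s\<close> one variable at a time.
\<close>

lemma mact_eval_A:
  fixes G :: "('n::finite, 'a::finite_field) mpol"
  assumes "\<And>y. msubst (mvar(j := y)) G = G"
  shows "mact (eval_A p (mvar j)) (G * mvar j) = G * carlitz_act p (mvar j)"
proof -
  have "mact (eval_A p (mvar j)) (G * (eval_A carlitz_theta ^^ i) (mvar j))
      = G * carlitz_act p ((eval_A carlitz_theta ^^ i) (mvar j))" for i
  proof (induction p arbitrary: i)
    case (pCons c p)
    have "mact (eval_A (pCons c p) (mvar j)) (G * (eval_A carlitz_theta ^^ i) (mvar j))
      = mconst (to_fract c) * (G * (eval_A carlitz_theta ^^ i) (mvar j))
        + mact (eval_A p (mvar j)) (mact (mvar j) (G * (eval_A carlitz_theta ^^ i) (mvar j)))"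
      by (simp add: eval_A_pCons mact_add_left mact_mconst mult.commute[of "mvar j"] mact_mult)
    also have "mact (mvar j) (G * (eval_A carlitz_theta ^^ i) (mvar j))
      = G * (eval_A carlitz_theta ^^ Suc i) (mvar j)"
      by (simp add: mact_mvar msubst_mult assms msubst_eval_A_iter funpow_swap1)
    finally show ?case unfolding pCons.IH by (simp add: carlitz_act_pCons algebra_simps)
  qed simp
  from this[of 0] show ?thesis by simp
qed

lemma mact_prod_eval_A:
  fixes p :: "'n::finite \<Rightarrow> 'a::finite_field poly poly"
  shows "mact (\<Prod>v\<in>UNIV. eval_A (p v) (mvar v)) (\<Prod>v\<in>UNIV. mvar v) = (\<Prod>v\<in>UNIV. carlitz_act (p v) (mvar v))"
proof -
  have "mact (\<Prod>v\<in>J. eval_A (p v) (mvar v)) (\<Prod>v\<in>UNIV. mvar v)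
      = (\<Prod>v\<in>J. carlitz_act (p v) (mvar v)) * (\<Prod>v\<in>- J. mvar v)" for J
  proof (induction J rule: finite_induct[OF finite])
    case 1
    show ?case using mact_mconst[of 1] by simp
  next
    case (2 j J)
    define G :: "('n, 'a) mpol" where "G = (\<Prod>v\<in>J. carlitz_act (p v) (mvar v)) * (\<Prod>v\<in>- insert j J. mvar v)"
    have J: "- J = insert j (- insert j J)" using 2 by auto
    have "msubst (mvar(j := y)) G = G" for y
    proof -
      have "(\<Prod>v\<in>J. carlitz_act (p v) ((mvar(j := y)) v)) = (\<Prod>v\<in>J. carlitz_act (p v) (mvar v))"
        using 2 by (intro prod.cong) auto
      moreover have "(\<Prod>v\<in>- insert j J. (mvar(j := y)) v) = (\<Prod>v\<in>- insert j J. mvar v)"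
        by (intro prod.cong) auto
      ultimately show ?thesis
        by (simp only: G_def msubst_mult msubst_prod msubst_carlitz_act msubst_mvar)
    qed
    hence "mact (eval_A (p j) (mvar j)) (G * mvar j) = G * carlitz_act (p j) (mvar j)"
      by (rule mact_eval_A)
    moreover have "(\<Prod>v\<in>J. carlitz_act (p v) (mvar v)) * (\<Prod>v\<in>- J. mvar v) = G * mvar j"
      unfolding G_def J by (simp add: mult_ac)
    ultimately show ?case
      using 2 by (simp add: mact_mult G_def mult_ac)
  qed
  from this[of UNIV] show ?thesis by simp
qed

definition act_vars :: "('n::finite, 'a::finite_field) mpol \<Rightarrow> ('n, 'a) mpol" where
  "act_vars F = mact F (\<Prod>v\<in>UNIV. mvar v)"

lemma act_vars_0 [simp]: "act_vars 0 = 0"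
  by (simp add: act_vars_def)

lemma act_vars_add: "act_vars (F + G) = act_vars F + act_vars G"
  by (simp add: act_vars_def mact_add_left)

lemma act_vars_sum: "act_vars (sum f I) = (\<Sum>i\<in>I. act_vars (f i))"
  by (induction I rule: infinite_finite_induct) (simp_all add: act_vars_add)

lemma act_vars_scale: "act_vars (mconst c * F) = mconst c * act_vars F"
  by (simp add: act_vars_def mact_mult mact_mconst)

lemma act_vars_prod_eval_A: "act_vars (\<Prod>v\<in>UNIV. eval_A (p v) (mvar v))
  = (\<Prod>v\<in>UNIV. carlitz_act (p v) (mvar v))"
  unfolding act_vars_def by (rule mact_prod_eval_A)

lemma act_vars_prod_at_var: "act_vars (\<Prod>v\<in>UNIV. at_var a v) = (\<Prod>v\<in>UNIV. eval_A (carlitz a) (mvar v))"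
  by (simp add: at_var_eq act_vars_prod_eval_A carlitz_act_lift_coeffs)

text \<open>
  Both sides are additive, so a monomial suffices.  There everything splits over the variables,
  and \<open>(t\<^sub>j - \<theta>)\<close> acts on \<open>y\<close>, an iterate of \<open>C\<^sub>\<theta>\<close> at \<open>X\<^sub>j\<close>, by
  \<open>C\<^sub>\<theta>(y) - \<theta> y = y\<^sup>q\<close>.
\<close>

lemma act_vars_twist:
  fixes F :: "('n::finite, 'a::finite_field) mpol"
  shows "act_vars (newton_prod 1 * coeff_frob 1 F) = act_vars F ^ CARD('a)"
proof (induction F rule: mpol_induct)
  case (single m c)
  define e where "e = Poly_Mapping.lookup m"
  have F: "Poly_Mapping.single m c = mconst c * (\<Prod>v\<in>UNIV. eval_A (monom 1 (e v)) (mvar v))"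
    using msubst_mvar_id[of "Poly_Mapping.single m c"]
    by (simp add: msubst_single e_def monom_altdef eval_A_smult eval_A_power eval_A_pCons)
  have factor: "eval_A ([:- theta, 1:] * monom 1 k) (mvar v :: ('n, 'a) mpol)
      = (mvar v - mconst (to_fract theta)) * mvar v ^ k" for k v
    unfolding eval_A_mult
    by (simp add: monom_altdef eval_A_smult eval_A_power eval_A_pCons mconst_def single_uminus)
  have "newton_prod 1 * coeff_frob 1 (Poly_Mapping.single m c)
      = mconst (c ^ CARD('a)) * (\<Prod>v\<in>UNIV. eval_A ([:- theta, 1:] * monom 1 (e v)) (mvar v))"
    unfolding factor prod.distrib
    by (simp add: F coeff_frob_mult coeff_frob_mconst coeff_frob_prod newton_prod_def eval_A_newton_poly
      monom_altdef eval_A_smult eval_A_power eval_A_pCons coeff_frob_power coeff_frob_mvar mult_ac)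
  also have "act_vars \<dots> = mconst (c ^ CARD('a))
    * (\<Prod>v\<in>UNIV. (eval_A carlitz_theta ^^ e v) (mvar v) ^ CARD('a))"
  proof -
    have "[:- theta, 1 :: 'a poly:] * monom 1 n = monom (- theta) n + monom 1 (Suc n)" for n
      by (simp add: smult_monom monom_Suc)
    hence "carlitz_act ([:- theta, 1:] * monom 1 n) y = (eval_A carlitz_theta ^^ n) y ^ CARD('a)"
      for n and y :: "('n, 'a) mpol"
      by (simp only: carlitz_act_add carlitz_act_monom)
        (simp add: eval_A_carlitz_theta mconst_def single_uminus)
    thus ?thesis
      unfolding act_vars_scale act_vars_prod_eval_A by simp
  qed
  finally show ?case
    by (simp add: F act_vars_scale act_vars_prod_eval_A carlitz_act_monom power_mult_distrib prod_power_distrib mconst_power)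
next
  case (add F G)
  thus ?case
    using power_card_add_M[where 'a
      = 'a, of "act_vars F" "act_vars G" 1] by (simp add: coeff_frob_add act_vars_add distrib_left)
qed

text \<open>
  \<open>X\<^sub>1 \<cdots> X\<^sub>s Z\<close> has a single nonzero coefficient, so the action only produces powers
  \<open>Z\<^bsup>q^k\<^esup>\<close>.
\<close>

lemma act_XZ_nth_sum_any:
  "fps_nth (act f XZ :: ('n::finite, 'a::finite_field) mpol fps) N
    = Sum_any (\<lambda>(k, n). (act_vars (fps_nth f k) when n = 1) when n * CARD('a) ^ k = N)"
proof -
  have "mact F 0 = 0" for F :: "('n, 'a) mpol"
    using mact_add_right[of F 0 0] by simp
  hence "mact (fps_nth f k) (fps_nth XZ n) = (act_vars (fps_nth f k) when n = 1)" for k n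
    by (simp add: XZ_def act_vars_def when_def)
  thus ?thesis by (simp add: act_def)
qed

lemma act_XZ_nth_power:
  "fps_nth (act f XZ :: ('n::finite, 'a::finite_field) mpol fps) (CARD('a) ^ k) = act_vars (fps_nth f k)"
proof -
  have "(\<lambda>(j, n). (act_vars (fps_nth f j) when n = 1) when n * CARD('a) ^ j = CARD('a) ^ k)
      = (\<lambda>p. act_vars (fps_nth f k) when p = (k, 1))"
    using card_ge_2[where 'a = 'a] by (auto simp: fun_eq_iff when_def)
  thus ?thesis by (simp add: act_XZ_nth_sum_any)
qed

lemma act_XZ_nth_0:
  assumes "\<And>k. N \<noteq> CARD('a) ^ k"
  shows "fps_nth (act f XZ :: ('n::finite, 'a::finite_field) mpol fps) N = 0"
proof -
  have "(\<lambda>(j, n). (act_vars (fps_nth f j) when n = 1) when n * CARD('a) ^ j = N) = (\<lambda>p. 0)"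
    using assms by (auto simp: fun_eq_iff when_def)
  thus ?thesis by (simp add: act_XZ_nth_sum_any)
qed

lemma act_tau_z:
  fixes f :: "('n::finite, 'a::finite_field) mpol fps"
  shows "act (tau_z f) XZ = act f XZ ^ CARD('a)"
proof (rule fps_ext)
  fix N
  define q where "q = CARD('a)"
  have q: "q \<ge> 2" by (simp add: q_def card_ge_2)
  have rhs: "fps_nth (act f XZ ^ q) N = (if q dvd N then fps_nth (act f XZ) (N div q) ^ q else 0)"
    using fps_power_card_nth[of "act f XZ" 1 N] by (simp add: q_def)
  have "fps_nth (act (tau_z f) XZ) N = (if q dvd N then fps_nth (act f XZ) (N div q) ^ q else 0)"
  proof (cases "\<exists>k. N = q ^ k")
    case True
    then obtain k where k: "N = q ^ k" by blast
    show ?thesis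
    proof (cases k)
      case 0
      thus ?thesis using q k act_XZ_nth_power[of "tau_z f" 0] by (auto simp: tau_z_nth)
    next
      case (Suc m)
      have "fps_nth (act (tau_z f) XZ) N = act_vars (fps_nth f m) ^ q"
        unfolding k Suc q_def act_XZ_nth_power using act_vars_twist[of "fps_nth f m"] by (simp add: tau_z_nth)
      moreover have "fps_nth (act f XZ) (N div q) = act_vars (fps_nth f m)"
        using q unfolding k Suc by (simp add: act_XZ_nth_power q_def)
      ultimately show ?thesis by (simp add: k Suc)
    qed
  next
    case False
    have "fps_nth (act f XZ) (N div q) = 0" if "q dvd N"
    proof (rule act_XZ_nth_0)
      show "N div q \<noteq> CARD('a) ^ k" for k
        using False that unfolding q_def[symmetric] by (metis dvd_mult_div_cancel power_Suc)
    qed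
    moreover have "fps_nth (act (tau_z f) XZ) N = 0"
      using False by (intro act_XZ_nth_0) (auto simp: q_def)
    ultimately show ?thesis using q by (auto simp: power_0_left)
  qed
  thus "fps_nth (act (tau_z f) XZ) N = fps_nth (act f XZ ^ CARD('a)) N"
    using rhs by (simp add: q_def)
qed

lemma act_tau_z_funpow:
  fixes f :: "('n::finite, 'a::finite_field) mpol fps"
  shows "act ((tau_z ^^ j) f) XZ = act f XZ ^ (CARD('a) ^ j)"
  by (induction j) (simp_all add: act_tau_z mult.commute flip: power_mult)

lemma less_power_card: "k < CARD('a::finite_field) ^ k"
  by (rule order_less_le_trans[OF less_exp power_mono[OF card_ge_2]]) simp

text \<open>
  Instances are the exponential and the logarithm: both are obtained from the iterates of
  \<open>\<tau>\<^sub>z\<close>, and the action carries these to iterated \<open>q\<close>-th powers.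
\<close>

lemma act_twisted_series:
  fixes f :: "('n::finite, 'a::finite_field) mpol fps"
  shows "act (suminf (\<lambda>j. fps_const (mconst (c j)) * (tau_z ^^ j) f)) XZ
    = suminf (\<lambda>j. fps_const (mconst (c j)) * act f XZ ^ (CARD('a) ^ j))"
proof (rule fps_ext)
  fix N
  let ?S = "suminf (\<lambda>j. fps_const (mconst (c j)) * (tau_z ^^ j) f)"
  have vanish: "fps_nth (act ((tau_z ^^ j) f) XZ) M = 0" if "M < j" for M j
  proof (cases "\<exists>k. M = CARD('a) ^ k")
    case True
    then obtain k where k: "M = CARD('a) ^ k" by blast
    hence "k < j" using that less_power_card[of k, where 'a = 'a] by simp
    thus ?thesis by (simp add: k act_XZ_nth_power tau_z_funpow_nth)
  qed (auto intro: act_XZ_nth_0)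
  have "fps_nth (suminf (\<lambda>j. fps_const (mconst (c j)) * act f XZ ^ (CARD('a) ^ j))) N
      = (\<Sum>j\<le>N. mconst (c j) * fps_nth (act ((tau_z ^^ j) f) XZ) N)"
    by (subst suminf_fps_nth[where N = "\<lambda>n. n"]) (simp_all add: vanish flip: act_tau_z_funpow)
  also have "\<dots> = fps_nth (act ?S XZ) N"
  proof (cases "\<exists>k. N = CARD('a) ^ k")
    case True
    then obtain k where k: "N = CARD('a) ^ k" by blast
    hence "k < N" using less_power_card[of k, where 'a = 'a] by simp
    have "(\<Sum>j\<le>N. mconst (c j) * fps_nth (act ((tau_z ^^ j) f) XZ) N)
        = (\<Sum>j\<le>N. mconst (c j) * act_vars (fps_nth ((tau_z ^^ j) f) k))"
      by (simp add: k act_XZ_nth_power)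
    also have "\<dots> = (\<Sum>j\<le>k. mconst (c j) * act_vars (fps_nth ((tau_z ^^ j) f) k))"
      using \<open>k < N\<close> by (intro sum.mono_neutral_right) (auto simp: tau_z_funpow_nth)
    also have "\<dots> = fps_nth (act ?S XZ) N"
      by (simp add: k act_XZ_nth_power twisted_series_nth act_vars_sum tau_z_funpow_nth act_vars_scale mult.assoc)
    finally show ?thesis .
  next
    case False
    thus ?thesis by (simp add: act_XZ_nth_0)
  qed
  finally show "fps_nth (act ?S XZ) N
      = fps_nth (suminf (\<lambda>j. fps_const (mconst (c j)) * act f XZ ^ (CARD('a) ^ j))) N" ..
qed

lemma act_exp_z: "act (exp_z f) XZ = exp_C (act f XZ)"
  unfolding exp_z_def exp_C_def by (rule act_twisted_series)

lemma act_log_z: "act (log_z f) XZ = log_C (act f XZ)"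
  unfolding log_z_def log_C_def by (rule act_twisted_series)

lemma act_L_series: "act L_series XZ = (l_series :: ('n::finite, 'a::finite_field) mpol fps)"
proof (rule fps_ext)
  fix N
  define g :: "nat \<Rightarrow> ('n, 'a) mpol fps"
    where "g d = fps_X ^ (CARD('a) ^ d) * fps_const (act_vars (power_sum d))" for d
  have g: "fps_nth (g d) k = (if k = CARD('a) ^ d then act_vars (power_sum d) else 0)" for d k
    by (auto simp: g_def fps_X_power_mult_nth)
  have "l_series = suminf g"
    by (simp add: l_series_def g_def[abs_def] power_sum_def act_vars_sum act_vars_scale act_vars_prod_at_var)
  also have "fps_nth (suminf g) N = (\<Sum>d\<le>N. fps_nth (g d) N)"
  proof (rule suminf_fps_nth)
    fix k d :: nat
    assume "d > k"
    hence "k \<noteq> CARD('a) ^ d" using less_power_card[of d, where 'a = 'a] by linarith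
    thus "fps_nth (g d) k = 0" by (simp add: g)
  qed
  also have "\<dots> = fps_nth (act L_series XZ) N"
  proof (cases "\<exists>k. N = CARD('a) ^ k")
    case True
    then obtain k where k: "N = CARD('a) ^ k" by blast
    hence "k < N" using less_power_card[of k, where 'a = 'a] by simp
    have "(\<Sum>d\<le>N. fps_nth (g d) N) = (\<Sum>d\<le>N. if d = k then act_vars (power_sum d) else 0)"
      using card_ge_2[where 'a = 'a] by (intro sum.cong) (auto simp: g k)
    also have "\<dots> = act_vars (power_sum k)" using \<open>k < N\<close> by simp
    finally show ?thesis by (simp add: k act_XZ_nth_power L_series_nth)
  next
    case False
    thus ?thesis using act_XZ_nth_0[of N] by (auto simp: g)
  qed
  finally show "fps_nth (act L_series XZ) N = fps_nth (l_series :: ('n, 'a) mpol fps) N" ..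
qed

section \<open>Polynomials over the ring A and Newton interpolation\<close>

text \<open>
  The standard system of residues modulo any polynomial of degree \<open>d\<close>.
\<close>

definition polys_below :: "nat \<Rightarrow> 'a::finite_field poly set" where
  "polys_below d = {a. \<forall>i\<ge>d. coeff a i = 0}"

lemma polys_below_Suc: "polys_below (Suc d) = (\<lambda>(c, a). pCons c a) ` (UNIV \<times> polys_below d)"
proof (intro equalityI subsetI)
  fix a :: "'a poly"
  assume a: "a \<in> polys_below (Suc d)"
  obtain c b where ab: "a = pCons c b" by (cases a)
  have "coeff b i = 0" if "i \<ge> d" for i
  proof -
    have "coeff a (Suc i) = 0" using a that by (simp add: polys_below_def)
    thus ?thesis by (simp add: ab)
  qed
  thus "a \<in> (\<lambda>(c, a). pCons c a) ` (UNIV \<times> polys_below d)"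
    by (auto simp: ab polys_below_def)
next
  fix a :: "'a poly"
  assume "a \<in> (\<lambda>(c, a). pCons c a) ` (UNIV \<times> polys_below d)"
  then obtain c b where ab: "a = pCons c b" "b \<in> polys_below d" by auto
  have "coeff a i = 0" if "i \<ge> Suc d" for i
  proof (cases i)
    case (Suc j)
    thus ?thesis using ab that by (simp add: polys_below_def)
  qed (use that in simp)
  thus "a \<in> polys_below (Suc d)" by (simp add: polys_below_def)
qed

lemma finite_card_polys_below:
  "finite (polys_below d :: 'a::finite_field poly set) \<and> card (polys_below d :: 'a poly set) = CARD('a) ^ d"
proof (induction d)
  case 0
  have "polys_below 0 = {0 :: 'a poly}"
    by (auto simp: polys_below_def poly_eq_iff)
  thus ?case by simp
next
  case (Suc d)
  have "inj_on (\<lambda>(c, a). pCons c a) (UNIV \<times> polys_below d :: ('a \<times> 'a poly) set)"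
    by (auto intro: inj_onI)
  hence "card (polys_below (Suc d) :: 'a poly set) = CARD('a) * card (polys_below d :: 'a poly set)"
    unfolding polys_below_Suc by (simp only: card_image card_cartesian_product)
  moreover have "finite (polys_below (Suc d) :: 'a poly set)"
    unfolding polys_below_Suc using Suc by (intro finite_imageI finite_cartesian_product) simp_all
  ultimately show ?case using Suc by simp
qed

lemmas finite_polys_below = finite_card_polys_below[THEN conjunct1]
  and card_polys_below = finite_card_polys_below[THEN conjunct2]

lemma degree_less_polys_below: "a \<noteq> 0 \<Longrightarrow> a \<in> polys_below d \<Longrightarrow> degree a < d"
  using leading_coeff_neq_0[of a] by (force simp: polys_below_def not_less[symmetric])

lemma not_dvd_polys_below:
  "a \<noteq> 0 \<Longrightarrow> a \<in> polys_below (degree P) \<Longrightarrow> \<not> P dvd (a :: 'a::finite_field poly)"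
  using degree_less_polys_below[of a "degree P"] dvd_imp_degree_le[of P a] by auto

lemma finite_monic_deg: "finite (monic_deg d)"
proof (rule finite_subset)
  show "monic_deg d \<subseteq> polys_below (Suc d)"
    by (auto simp: monic_deg_def polys_below_def coeff_eq_0)
qed (rule finite_polys_below)

lemma diff_dvd_poly_diff: "x - y dvd poly f x - poly f (y :: 'r::comm_ring_1)"
proof (induction f)
  case (pCons c f)
  have "poly (pCons c f) x - poly (pCons c f) y = (x - y) * poly f x + y * (poly f x - poly f y)"
    by (simp add: algebra_simps)
  thus ?case using pCons.IH by simp
qed simp

text \<open>
  Over the domain of residues modulo \<open>P\<close> a nonzero polynomial has at most as many roots as its
  degree.  Dividing by \<open>T - r\<close> over the original ring gives this without passing to the quotient.
\<close>

lemma const_dvd_if_many_roots: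
  fixes P :: "'r::idom"
  assumes "prime_elem P" "finite S" "degree f < card S"
    and "\<And>r. r \<in> S \<Longrightarrow> P dvd poly f r"
    and "\<And>r s. r \<in> S \<Longrightarrow> s \<in> S \<Longrightarrow> r \<noteq> s \<Longrightarrow> \<not> P dvd r - s"
  shows "[:P:] dvd f"
  using assms(2-)
proof (induction "degree f" arbitrary: f S)
  case 0
  then obtain c where "f = [:c:]" by (metis degree_eq_zeroE)
  moreover from 0 obtain r where "r \<in> S" by fastforce
  ultimately show ?case using 0 by auto
next
  case (Suc n)
  then obtain r where r: "r \<in> S" by fastforce
  define g where "g = synthetic_div f r"
  have f: "f = [:-r, 1:] * g + [:poly f r:]"
    unfolding g_def by (rule synthetic_div_correct'[symmetric])
  have "[:P:] dvd g"
  proof (rule Suc.hyps(1)[of g "S - {r}"])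
    show "n = degree g" using Suc.hyps(2) by (simp add: g_def degree_synthetic_div)
    thus "degree g < card (S - {r})" using Suc.hyps(2) Suc.prems r by simp
    fix s assume s: "s \<in> S - {r}"
    have "poly f s = (s - r) * poly g s + poly f r"
      by (subst f) (simp add: algebra_simps)
    hence "(s - r) * poly g s = poly f s - poly f r" by simp
    hence "P dvd (s - r) * poly g s" using Suc.prems(3) s r by simp
    thus "P dvd poly g s"
      using assms(1) Suc.prems(4)[of s r] s r by (auto dest: prime_elem_dvd_multD)
  qed (use Suc.prems in auto)
  moreover have "[:P:] dvd [:poly f r:]"
    using Suc.prems(3)[OF r] by simp
  ultimately show ?case
    by (subst f) (intro dvd_add dvd_mult)
qed

lemma of_nat_card: "of_nat CARD('a::finite_field) = (0 :: 'a)"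
proof -
  have "bij (\<lambda>x::'a. x + 1)"
    by (rule bij_betw_byWitness[where f' = "\<lambda>x. x - 1"]) auto
  hence "(\<Sum>x\<in>UNIV. x + 1) = (\<Sum>x\<in>UNIV. x :: 'a)"
    by (rule sum.reindex_bij_betw)
  thus ?thesis by (simp add: sum.distrib)
qed

lemma poly_newton_poly_Suc:
  "poly (newton_poly (Suc k)) x
    = poly (newton_poly k) x * (x - theta ^ (CARD('a) ^ k) :: 'a::finite_field poly)"
  by (simp add: newton_poly_def algebra_simps)

text \<open>
  \<open>D\<^sub>n\<close> is the product of \<open>\<theta>\<^bsup>q^n\<^esup> - \<theta>\<^bsup>q^i\<^esup>\<close> over \<open>i < n\<close>.  The factors with
  \<open>i < k\<close> make up \<open>b\<^sub>k(\<theta>\<^bsup>q^n\<^esup>)\<close>, and the others are \<open>q\<^sup>k\<close>-th powers of the factors of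
  \<open>D\<^sub>n\<^sub>-\<^sub>k\<close>.
\<close>

lemma carlitz_D_newton_poly:
  assumes "k \<le> n"
  shows "carlitz_D n = poly (newton_poly k) (theta ^ (CARD('a) ^ n))
    * (carlitz_D (n - k) :: 'a::finite_field poly) ^ (CARD('a) ^ k)"
  using assms
proof (induction k)
  case (Suc k)
  define q where "q = CARD('a)"
  have n: "n - k = Suc (n - Suc k)" using Suc.prems by simp
  have "(carlitz_D (n - k) :: 'a poly) ^ (q ^ k)
      = (theta ^ (q ^ (n - k)) - theta) ^ (q ^ k) * carlitz_D (n - Suc k) ^ (q * q ^ k)"
    by (simp add: n q_def power_mult_distrib flip: power_mult)
  also have "(theta ^ (q ^ (n - k)) - theta :: 'a poly) ^ (q ^ k) = theta ^ (q ^ n) - theta ^ (q ^ k)"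
    using Suc.prems by (simp add: q_def power_card_diff_A flip: power_mult power_add)
  finally show ?case
    using Suc unfolding poly_newton_poly_Suc by (simp add: q_def mult.assoc)
qed (simp add: newton_poly_def)

lemma poly_newton_poly_eq_0: "n < k \<Longrightarrow> poly (newton_poly k) (theta ^ (CARD('a) ^ n))
  = (0 :: 'a::finite_field poly)"
  by (auto simp: newton_poly_def poly_prod)

lemma degree_newton_poly: "degree (newton_poly k :: 'a::finite_field poly poly) = k"
  and lead_coeff_newton_poly: "coeff (newton_poly k :: 'a::finite_field poly poly) k = 1"
proof -
  have "degree (newton_poly k :: 'a poly poly) = k \<and> lead_coeff (newton_poly k :: 'a poly poly) = 1"
  proof (induction k)
    case (Suc k)
    define l where "l = [:- (theta ^ (CARD('a) ^ k)), 1::'a poly:]"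
    have *: "newton_poly (Suc k) = newton_poly k * l"
      by (simp add: newton_poly_def l_def)
    have "newton_poly k \<noteq> (0 :: 'a poly poly)" "coeff (newton_poly k :: 'a poly poly) k = 1" using Suc by auto
    moreover have "l \<noteq> 0" "degree l = 1" "lead_coeff l = 1" by (simp_all add: l_def)
    ultimately show ?case
      using Suc lead_coeff_mult[of "newton_poly k" l] unfolding * by (simp add: degree_mult_eq)
  qed (simp add: newton_poly_def)
  thus "degree (newton_poly k :: 'a poly poly) = k" "coeff (newton_poly k :: 'a poly poly) k = 1" by auto
qed

lemma newton_expansion:
  fixes f :: "'a::finite_field poly poly"
  assumes "degree f \<le> N"
  shows "\<exists>c. f = (\<Sum>k\<le>N. smult (c k) (newton_poly k)) \<and> c N = coeff f N"
  using assms
proof (induction N arbitrary: f)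
  case 0
  then obtain a where "f = [:a:]" by (auto elim: degree_eq_zeroE)
  thus ?case by (auto simp: newton_poly_def intro!: exI[of _ "\<lambda>_. a"])
next
  case (Suc N)
  define g where "g = f - smult (coeff f (Suc N)) (newton_poly (Suc N))"
  have "coeff g i = 0" if "i > N" for i
    using that Suc.prems
    by (cases "i = Suc N") (auto simp: g_def coeff_eq_0 degree_newton_poly lead_coeff_newton_poly)
  hence "degree g \<le> N" by (auto intro: degree_le)
  from Suc.IH[OF this] obtain c where c: "g = (\<Sum>k\<le>N. smult (c k) (newton_poly k))" by blast
  define c' where "c' = c(Suc N := coeff f (Suc N))"
  have "f = (\<Sum>k\<le>Suc N. smult (c' k) (newton_poly k))"
    using c by (simp add: g_def c'_def algebra_simps)
  thus ?case by (intro exI[of _ c'] conjI) (assumption, simp add: c'_def)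
qed

section \<open>Polynomials with coefficients in a given set\<close>

text \<open>
  Used for a localisation of \<open>A\<close>, for its maximal ideal, and for the elements of bounded degree.
\<close>

definition coeffs_in :: "'a::finite_field poly fract set \<Rightarrow> ('n, 'a) mpol set" where
  "coeffs_in S = {F. \<forall>m. Poly_Mapping.lookup F m \<in> S}"

lemma coeffs_in_add:
  "(\<And>x y. x \<in> S \<Longrightarrow> y \<in> S \<Longrightarrow> x + y \<in> S) \<Longrightarrow> F \<in> coeffs_in S \<Longrightarrow> G \<in> coeffs_in S \<Longrightarrow> F + G \<in> coeffs_in S"
  by (simp add: coeffs_in_def lookup_add)

lemma coeffs_in_sum:
  assumes "0 \<in> S" "\<And>x y. x \<in> S \<Longrightarrow> y \<in> S \<Longrightarrow> x + y \<in> S" "\<And>i. i \<in> I \<Longrightarrow> F i \<in> coeffs_in S"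
  shows "sum F I \<in> coeffs_in S"
  using assms(3)
  by (induction I rule: infinite_finite_induct)
    (auto simp: coeffs_in_def assms(1,2) lookup_add)

lemma coeffs_in_single: "0 \<in> S \<Longrightarrow> c \<in> S \<Longrightarrow> Poly_Mapping.single m c \<in> coeffs_in S"
  by (simp add: coeffs_in_def lookup_single when_def)

lemma coeffs_in_mconst: "0 \<in> S \<Longrightarrow> c \<in> S \<Longrightarrow> mconst c \<in> coeffs_in S"
  by (simp add: mconst_def coeffs_in_single)

lemma coeffs_in_mvar: "0 \<in> S \<Longrightarrow> 1 \<in> S \<Longrightarrow> mvar v \<in> coeffs_in S"
  by (simp add: mvar_def coeffs_in_single)

lemma coeffs_in_mult:
  assumes "F \<in> coeffs_in S" "G \<in> coeffs_in T"
    and U: "0 \<in> U" "\<And>x y. x \<in> U \<Longrightarrow> y \<in> U \<Longrightarrow> x + y \<in> U"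
    and "\<And>x y. x \<in> S \<Longrightarrow> y \<in> T \<Longrightarrow> x * y \<in> U"
  shows "F * G \<in> coeffs_in U"
proof -
  have expand: "H = (\<Sum>m\<in>Poly_Mapping.keys H. Poly_Mapping.single m (Poly_Mapping.lookup H m))"
    for H :: "('a, 'b) mpol"
    by (intro poly_mapping_eqI) (auto simp: lookup_sum lookup_single when_def in_keys_iff)
  have "F * G = (\<Sum>m\<in>Poly_Mapping.keys F. \<Sum>k\<in>Poly_Mapping.keys G.
      Poly_Mapping.single (m + k) (Poly_Mapping.lookup F m * Poly_Mapping.lookup G k))"
    by (subst expand[of F], subst expand[of G]) (simp add: sum_product mult_single)
  also have "\<dots> \<in> coeffs_in U"
    using assms by (intro coeffs_in_sum U coeffs_in_single) (auto simp: coeffs_in_def)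
  finally show ?thesis .
qed

section \<open>Localisation at a prime\<close>

text \<open>
  \<open>P\<close> is normalised to be monic so that multiplication by \<open>P\<close> preserves monic polynomials.
\<close>

locale monic_prime =
  fixes P :: "'a::finite_field poly"
  assumes prime: "prime_elem P" and monic: "lead_coeff P = 1"
begin

abbreviation d :: nat where "d \<equiv> degree P"

lemma degree_pos: "0 < d"
proof -
  have "d \<noteq> 0"
  proof
    assume "d = 0"
    then obtain c where c: "P = [:c:]" by (rule degree_eq_zeroE)
    with monic have "P = 1" by (simp add: one_pCons)
    thus False using prime by simp
  qed
  thus ?thesis by simp
qed

text \<open>
  Multiplication by \<open>a\<close> prime to \<open>P\<close> permutes the \<open>q\<^sup>d - 1\<close> nonzero residues; compare their
  product before and after.
\<close>

lemma fermat: "P dvd a ^ (CARD('a) ^ d) - a"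
proof (cases "P dvd a")
  case True
  moreover have "a dvd a ^ (CARD('a) ^ d)" by (intro dvd_power) simp
  ultimately show ?thesis by (meson dvd_diff dvd_trans)
next
  case False
  define R where "R = (polys_below d :: 'a poly set) - {0}"
  have R: "finite R" "r \<in> R \<Longrightarrow> \<not> P dvd r" for r
    by (auto simp: R_def finite_polys_below not_dvd_polys_below)
  have "0 \<in> (polys_below d :: 'a poly set)" by (simp add: polys_below_def)
  hence card: "Suc (card R) = CARD('a) ^ d"
    using finite_polys_below[of d, where 'a = 'a] by (simp add: R_def card_polys_below)
  have P0: "P \<noteq> 0" using prime by auto
  have maps: "a * r mod P \<in> R" if "r \<in> R" for r
  proof -
    have "\<not> P dvd a * r" using that R False prime by (auto dest: prime_elem_dvd_multD)
    hence "a * r mod P \<noteq> 0" by (simp add: dvd_eq_mod_eq_0)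
    moreover from this have "degree (a * r mod P) < d" using P0 degree_mod_less[of P "a * r"] by simp
    ultimately show ?thesis by (auto simp: R_def polys_below_def coeff_eq_0)
  qed
  have "inj_on (\<lambda>r. a * r mod P) R"
  proof (rule inj_onI)
    fix r s assume rs: "r \<in> R" "s \<in> R" "a * r mod P = a * s mod P"
    hence "P dvd a * (r - s)" by (simp add: mod_eq_dvd_iff algebra_simps)
    hence "P dvd r - s" using False prime by (auto dest: prime_elem_dvd_multD)
    moreover have "r - s \<in> polys_below d" using rs by (auto simp: R_def polys_below_def)
    ultimately show "r = s" by (metis not_dvd_polys_below right_minus_eq)
  qed
  hence "bij_betw (\<lambda>r. a * r mod P) R R"
    using maps R by (intro bij_betw_imageI endo_inj_surj) auto
  hence "(\<Prod>r\<in>R. a * r mod P) = \<Prod>R"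
    using prod.reindex_bij_betw[of _ R R "\<lambda>x. x"] by blast
  hence "(\<Prod>r\<in>R. a * r) mod P = \<Prod>R mod P"
    by (metis mod_prod_eq)
  hence "P dvd (a ^ card R - 1) * \<Prod>R"
    by (simp add: mod_eq_dvd_iff prod.distrib algebra_simps)
  moreover have "\<not> P dvd \<Prod>R"
  proof -
    have "\<not> P dvd \<Prod>T" if "finite T" "\<And>r. r \<in> T \<Longrightarrow> \<not> P dvd r" for T
      using that by (induction T) (use prime in \<open>auto dest: prime_elem_dvd_multD\<close>)
    thus ?thesis using R by blast
  qed
  ultimately have "P dvd a ^ card R - 1" using prime by (auto dest: prime_elem_dvd_multD)
  hence "P dvd a * (a ^ card R - 1)" by simp
  thus ?thesis by (simp add: right_diff_distrib flip: power_Suc card)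
qed

text \<open>
  Otherwise the \<open>q\<^sup>m\<close>-th power would fix \<open>\<theta>\<close> and so every residue modulo \<open>P\<close>, and the
  polynomial \<open>T\<^bsup>q^m\<^esup> - T\<close> would have \<open>q\<^sup>d\<close> roots.
\<close>

lemma not_dvd_theta_power_diff:
  assumes "0 < m" "m < d"
  shows "\<not> P dvd theta ^ (CARD('a) ^ m) - theta"
proof
  assume dvd: "P dvd theta ^ (CARD('a) ^ m) - theta"
  define f :: "'a poly poly" where "f = monom 1 (CARD('a) ^ m) + [:0, -1:]"
  have q: "CARD('a) ^ m > 1" using assms card_ge_2[where 'a = 'a] by (intro one_less_power) auto
  have degf: "degree f = CARD('a) ^ m"
    unfolding f_def using q by (subst degree_add_eq_left) (auto simp: degree_monom_eq)
  have "[:P:] dvd f"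
  proof (rule const_dvd_if_many_roots[OF prime finite_polys_below[of d]])
    show "degree f < card (polys_below d :: 'a poly set)"
      using assms card_ge_2[where 'a = 'a] by (simp add: degf card_polys_below)
    fix r :: "'a poly"
    have "theta ^ (CARD('a) ^ m) - theta dvd poly (lift_coeffs r) (theta ^ (CARD('a) ^ m)) - poly (lift_coeffs r) theta"
      by (rule diff_dvd_poly_diff)
    with dvd have "P dvd r ^ (CARD('a) ^ m) - r"
      by (simp add: poly_lift_coeffs_power poly_lift_coeffs_theta dvd_trans)
    thus "P dvd poly f r" by (simp add: f_def poly_monom)
  next
    fix r s :: "'a poly"
    assume "r \<in> polys_below d" "s \<in> polys_below d" "r \<noteq> s"
    thus "\<not> P dvd r - s" by (intro not_dvd_polys_below) (auto simp: polys_below_def)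
  qed
  hence "P dvd coeff f (CARD('a) ^ m)" by (simp add: const_poly_dvd_iff)
  hence "P dvd 1" using q by (simp add: f_def coeff_pCons split: nat.splits)
  thus False using prime by auto
qed

lemma not_dvd_carlitz_D: "k < d \<Longrightarrow> \<not> P dvd carlitz_D k"
proof (induction k)
  case (Suc k)
  have "\<not> P dvd carlitz_D k ^ CARD('a)" using Suc prime by (auto dest: prime_elem_dvd_power)
  thus ?case
    using not_dvd_theta_power_diff[of "Suc k"] Suc.prems prime
    by (auto dest: prime_elem_dvd_multD)
qed (use prime in auto)

text \<open>
  The derivative of \<open>\<theta>\<^bsup>q^(n+1)\<^esup> - \<theta>\<close> is the unit \<open>-1\<close>.
\<close>

lemma not_square_dvd_theta_power_diff: "\<not> P * P dvd theta ^ (CARD('a) ^ Suc n) - theta"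
proof
  assume "P * P dvd theta ^ (CARD('a) ^ Suc n) - theta"
  then obtain k where k: "theta ^ (CARD('a) ^ Suc n) - theta = P * P * k" by (auto elim: dvdE)
  have "pderiv (theta ^ (CARD('a) ^ Suc n) - theta) = (-1 :: 'a poly)"
    by (simp add: of_nat_card pderiv_diff pderiv_power theta_def pderiv_pCons one_pCons)
  moreover have "P dvd pderiv (P * P * k)"
    by (auto simp: pderiv_mult intro!: dvd_add)
  ultimately have "P dvd -1" unfolding k by simp
  thus False using prime by auto
qed

text \<open>
  The recursion for \<open>D\<close> takes a \<open>q\<close>-th power and adds at most one further factor \<open>P\<close>, so the
  valuation of \<open>D\<^sub>n\<close> is at most \<open>1 + q + \<cdots> + q\<^bsup>n-1\<^esup>\<close>.
\<close>

lemma carlitz_D_valuation: "\<exists>e u. carlitz_D n = P ^ e * u \<and> \<not> P dvd u \<and> e < CARD('a) ^ n"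
proof (induction n)
  case 0
  show ?case using prime by (intro exI[of _ 0] exI[of _ 1]) auto
next
  case (Suc n)
  then obtain e u where eu: "carlitz_D n = P ^ e * u" "\<not> P dvd u" "e < CARD('a) ^ n" by blast
  obtain e' u' where eu': "theta ^ (CARD('a) ^ Suc n) - theta = P ^ e' * u'" "\<not> P dvd u'" "e' \<le> 1"
  proof (cases "P dvd theta ^ (CARD('a) ^ Suc n) - theta")
    case True
    then obtain u' where u': "theta ^ (CARD('a) ^ Suc n) - theta = P * u'" by (auto elim: dvdE)
    moreover have "\<not> P dvd u'" using not_square_dvd_theta_power_diff[of n] unfolding u' by auto
    ultimately show ?thesis using that[of 1 u'] by simp
  next
    case False
    thus ?thesis using that[of 0 "theta ^ (CARD('a) ^ Suc n) - theta"] by simp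
  qed
  have "carlitz_D (Suc n) = P ^ (e' + e * CARD('a)) * (u' * u ^ CARD('a))"
    unfolding carlitz_D.simps eu eu' by (simp add: power_mult_distrib power_add power_mult mult_ac)
  moreover have "\<not> P dvd u' * u ^ CARD('a)"
    using eu eu' prime by (auto dest: prime_elem_dvd_multD prime_elem_dvd_power)
  moreover have "e' + e * CARD('a) < CARD('a) ^ Suc n"
  proof -
    have "Suc e * CARD('a) \<le> CARD('a) ^ n * CARD('a)" using eu by (intro mult_right_mono) auto
    thus ?thesis using eu' card_ge_2[where 'a = 'a] by (simp add: mult.commute)
  qed
  ultimately show ?case by blast
qed

definition local_ring :: "'a poly fract set" where
  "local_ring = {to_fract a / to_fract b | a b. \<not> P dvd b}"

definition local_ideal :: "'a poly fract set" where
  "local_ideal = (\<lambda>x. to_fract P * x) ` local_ring"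

lemma local_ringI: "\<not> P dvd b \<Longrightarrow> to_fract a / to_fract b \<in> local_ring"
  by (auto simp: local_ring_def)

lemma local_ringE:
  assumes "x \<in> local_ring"
  obtains a b where "x = to_fract a / to_fract b" "\<not> P dvd b" "b \<noteq> 0"
  using assms by (auto simp: local_ring_def)

lemma to_fract_local: "to_fract a \<in> local_ring"
  using local_ringI[of 1 a] prime by auto

lemma local_0: "0 \<in> local_ring" and local_1: "1 \<in> local_ring"
  using to_fract_local[of 0] to_fract_local[of 1] by auto

lemma local_add: "x \<in> local_ring \<Longrightarrow> y \<in> local_ring \<Longrightarrow> x + y \<in> local_ring"
proof (elim local_ringE)
  fix a b a' b'
  assume *: "x = to_fract a / to_fract b" "\<not> P dvd b" "b \<noteq> 0"
    "y = to_fract a' / to_fract b'" "\<not> P dvd b'" "b' \<noteq> 0"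
  have "x + y = to_fract (a * b' + a' * b) / to_fract (b * b')"
    using * by (simp add: field_simps)
  moreover have "\<not> P dvd b * b'" using * prime by (auto dest: prime_elem_dvd_multD)
  ultimately show ?thesis by (metis local_ringI)
qed

lemma local_mult: "x \<in> local_ring \<Longrightarrow> y \<in> local_ring \<Longrightarrow> x * y \<in> local_ring"
proof (elim local_ringE)
  fix a b a' b'
  assume *: "x = to_fract a / to_fract b" "\<not> P dvd b" "b \<noteq> 0"
    "y = to_fract a' / to_fract b'" "\<not> P dvd b'" "b' \<noteq> 0"
  have "x * y = to_fract (a * a') / to_fract (b * b')"
    using * by simp
  moreover have "\<not> P dvd b * b'" using * prime by (auto dest: prime_elem_dvd_multD)
  ultimately show ?thesis by (metis local_ringI)
qed

lemma local_power: "x \<in> local_ring \<Longrightarrow> x ^ n \<in> local_ring"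
  by (induction n) (auto simp: local_1 local_mult)

lemma ideal_0: "0 \<in> local_ideal"
  using local_0 by (auto simp: local_ideal_def image_iff intro!: bexI[of _ 0])

lemma ideal_add: "x \<in> local_ideal \<Longrightarrow> y \<in> local_ideal \<Longrightarrow> x + y \<in> local_ideal"
  unfolding local_ideal_def using local_add by (auto simp: image_iff simp flip: distrib_left)

lemma ideal_mult: "x \<in> local_ideal \<Longrightarrow> y \<in> local_ring \<Longrightarrow> x * y \<in> local_ideal"
  unfolding local_ideal_def using local_mult by (auto simp: image_iff mult.assoc)

lemma ideal_uminus: "x \<in> local_ideal \<Longrightarrow> - x \<in> local_ideal"
  using ideal_mult[of x "-1"] to_fract_local[of "-1"] by simp

lemma ideal_diff: "x \<in> local_ideal \<Longrightarrow> y \<in> local_ideal \<Longrightarrow> x - y \<in> local_ideal"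
  using ideal_add[of x "-y"] ideal_uminus[of y] by simp

lemma to_fract_ideal: "P dvd a \<Longrightarrow> to_fract a \<in> local_ideal"
  using to_fract_local by (auto simp: local_ideal_def elim!: dvdE)

lemma ideal_cancel: "to_fract P * x \<in> local_ideal \<Longrightarrow> x \<in> local_ring"
  using prime by (auto simp: local_ideal_def)

lemma local_fermat: "x \<in> local_ring \<Longrightarrow> x ^ (CARD('a) ^ d) - x \<in> local_ideal"
proof (elim local_ringE)
  fix a b
  assume *: "x = to_fract a / to_fract b" "\<not> P dvd b" "b \<noteq> 0"
  have "x ^ (CARD('a) ^ d) - x
      = to_fract (a ^ (CARD('a) ^ d) * b - a * b ^ (CARD('a) ^ d)) * (1 / to_fract (b ^ (CARD('a) ^ d) * b))"
    using * by (simp add: power_divide to_fract_power diff_divide_eq_iff divide_diff_eq_iff)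
  moreover have "P dvd a ^ (CARD('a) ^ d) * b - a * b ^ (CARD('a) ^ d)"
  proof -
    have "a ^ (CARD('a) ^ d) * b - a * b ^ (CARD('a) ^ d)
      = (a ^ (CARD('a) ^ d) - a) * b - a * (b ^ (CARD('a) ^ d) - b)"
      by (simp add: algebra_simps)
    thus ?thesis using fermat[of a] fermat[of b] by simp
  qed
  moreover have "1 / to_fract (b ^ (CARD('a) ^ d) * b) \<in> local_ring"
  proof -
    have "\<not> P dvd b ^ (CARD('a) ^ d) * b"
      using * prime by (auto dest: prime_elem_dvd_multD prime_elem_dvd_power)
    thus ?thesis by (metis local_ringI to_fract_1)
  qed
  ultimately show ?thesis by (metis ideal_mult to_fract_ideal)
qed

text \<open>
  This makes \<open>exp\<^sub>z(P f)\<close> divisible by \<open>P\<close> whenever \<open>f\<close> is \<open>P\<close>-integral.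
\<close>

lemma power_over_carlitz_D: "to_fract P ^ (CARD('a) ^ n) / to_fract (carlitz_D n) \<in> local_ideal"
proof -
  obtain e u where eu: "carlitz_D n = P ^ e * u" "\<not> P dvd u" "e < CARD('a) ^ n"
    using carlitz_D_valuation by blast
  have P0: "to_fract P \<noteq> 0" using prime by auto
  obtain k where "CARD('a) ^ n = Suc (e + k)" using eu(3) less_iff_Suc_add by auto
  hence "to_fract P ^ (CARD('a) ^ n) / to_fract (carlitz_D n) = to_fract P * (to_fract (P ^ k) / to_fract u)"
    using P0 by (simp add: eu(1) to_fract_power power_add)
  thus ?thesis unfolding local_ideal_def using local_ringI[OF eu(2)] by blast
qed

subsection \<open>Polynomials over the localisation\<close>

lemma integral_mult:
  "F \<in> coeffs_in local_ring \<Longrightarrow> G \<in> coeffs_in local_ring \<Longrightarrow> F * G \<in> coeffs_in local_ring"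
  by (erule coeffs_in_mult) (auto intro: local_0 local_add local_mult)

lemma coeffs_ideal_mult:
  "F \<in> coeffs_in local_ideal \<Longrightarrow> G \<in> coeffs_in local_ring \<Longrightarrow> F * G \<in> coeffs_in local_ideal"
  by (erule coeffs_in_mult) (auto intro: ideal_0 ideal_add ideal_mult)

lemma coeffs_ideal_diff:
  "F \<in> coeffs_in local_ideal \<Longrightarrow> G \<in> coeffs_in local_ideal \<Longrightarrow> F - G \<in> coeffs_in local_ideal"
  by (simp add: coeffs_in_def lookup_minus ideal_diff)

lemmas coeffs_ideal_add = coeffs_in_add[of local_ideal, OF ideal_add]
lemmas coeffs_ideal_sum = coeffs_in_sum[OF ideal_0 ideal_add]
lemmas integral_sum = coeffs_in_sum[OF local_0 local_add]

lemma integral_prod: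
  "(\<And>i. i \<in> I \<Longrightarrow> F i \<in> coeffs_in local_ring) \<Longrightarrow> prod F I \<in> coeffs_in local_ring"
proof (induction I rule: infinite_finite_induct)
qed (simp_all add: integral_mult coeffs_in_mconst[OF local_0 local_1, simplified])

lemma integral_coeff_frob: "F \<in> coeffs_in local_ring \<Longrightarrow> coeff_frob j F \<in> coeffs_in local_ring"
  by (simp add: coeffs_in_def lookup_coeff_frob local_power)

lemma integral_eval_A: "eval_A p (mvar v) \<in> coeffs_in local_ring"
  by (induction p)
    (auto simp: eval_A_pCons coeffs_in_mconst[OF local_0 local_0, simplified]
      intro!: coeffs_in_add[OF local_add] integral_mult coeffs_in_mconst coeffs_in_mvar
        local_0 local_1 to_fract_local)

lemma integral_newton_prod: "newton_prod k \<in> coeffs_in local_ring"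
  unfolding newton_prod_def by (intro integral_prod integral_eval_A)

lemma coeff_frob_fermat: "F \<in> coeffs_in local_ring \<Longrightarrow> coeff_frob d F - F \<in> coeffs_in local_ideal"
  by (simp add: coeffs_in_def lookup_minus lookup_coeff_frob local_fermat)

lemma prod_congruent:
  assumes "finite I"
    and "\<And>i. i \<in> I \<Longrightarrow> F i \<in> coeffs_in local_ring" "\<And>i. i \<in> I \<Longrightarrow> G i \<in> coeffs_in local_ring"
    and "\<And>i. i \<in> I \<Longrightarrow> F i - G i \<in> coeffs_in local_ideal"
  shows "prod F I - prod G I \<in> coeffs_in local_ideal"
  using assms
proof (induction I)
  case empty
  show ?case by (simp add: coeffs_in_def ideal_0)
next
  case (insert i I)
  have "prod F (insert i I) - prod G (insert i I) = (F i - G i) * prod F I + (prod F I - prod G I) * G i"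
    using insert by (simp add: algebra_simps)
  also have "\<dots> \<in> coeffs_in local_ideal"
    using insert by (intro coeffs_ideal_add coeffs_ideal_mult integral_prod) auto
  finally show ?case .
qed

text \<open>
  The coefficients \<open>c\<^sub>k\<close> of \<open>P(T)\<close> in the Newton basis, extended by \<open>0\<close> beyond the degree of
  \<open>P\<close>.  They are also the coefficients of \<open>C\<^sub>P\<close>.
\<close>

definition newton_coeff :: "nat \<Rightarrow> 'a poly" where
  "newton_coeff = (SOME c. (\<forall>N\<ge>d. lift_coeffs P = (\<Sum>k\<le>N. smult (c k) (newton_poly k)))
     \<and> c d = 1 \<and> (\<forall>k>d. c k = 0))"

lemma newton_coeff:
  "N \<ge> d \<Longrightarrow> lift_coeffs P = (\<Sum>k\<le>N. smult (newton_coeff k) (newton_poly k))"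
  "newton_coeff d = 1" "k > d \<Longrightarrow> newton_coeff k = 0"
proof -
  have "degree (lift_coeffs P) \<le> d" by (simp add: degree_lift_coeffs)
  from newton_expansion[OF this] obtain c where
    c: "lift_coeffs P = (\<Sum>k\<le>d. smult (c k) (newton_poly k))" "c d = coeff (lift_coeffs P) d" by blast
  define c' where "c' k = (if k \<le> d then c k else 0)" for k
  have "lift_coeffs P = (\<Sum>k\<le>N. smult (c' k) (newton_poly k))" if "N \<ge> d" for N
    unfolding c(1) using that by (intro sum.mono_neutral_cong_left) (auto simp: c'_def)
  moreover have "c' d = 1" using monic by (simp add: c'_def c(2) coeff_lift_coeffs one_pCons)
  ultimately have "\<exists>c. (\<forall>N\<ge>d. lift_coeffs P = (\<Sum>k\<le>N. smult (c k) (newton_poly k)))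
     \<and> c d = 1 \<and> (\<forall>k>d. c k = 0)"
    by (intro exI[of _ c']) (auto simp: c'_def)
  from someI_ex[OF this, folded newton_coeff_def]
  show "N \<ge> d \<Longrightarrow> lift_coeffs P = (\<Sum>k\<le>N. smult (newton_coeff k) (newton_poly k))"
    "newton_coeff d = 1" "k > d \<Longrightarrow> newton_coeff k = 0" by blast+
qed

text \<open>
  This is \<open>P(T) = \<Sum> c\<^sub>k b\<^sub>k(T)\<close> at the node \<open>T = \<theta>\<^bsup>q^m\<^esup>\<close>, where \<open>b\<^sub>k\<close> vanishes for
  \<open>k > m\<close> and where \<open>P(T)\<close> takes the value \<open>P(\<theta>)\<^bsup>q^m\<^esup>\<close>.
\<close>

lemma power_expansion:
  "P ^ (CARD('a) ^ m) = (\<Sum>k\<le>m. newton_coeff k * poly (newton_poly k) (theta ^ (CARD('a) ^ m)))"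
proof -
  define N where "N = max d m"
  have "P ^ (CARD('a) ^ m) = poly (lift_coeffs P) (theta ^ (CARD('a) ^ m))"
    by (simp add: poly_lift_coeffs_power poly_lift_coeffs_theta)
  also have "\<dots> = (\<Sum>k\<le>N. newton_coeff k * poly (newton_poly k) (theta ^ (CARD('a) ^ m)))"
    by (subst newton_coeff(1)[of N]) (simp_all add: N_def poly_sum)
  also have "\<dots> = (\<Sum>k\<le>m. newton_coeff k * poly (newton_poly k) (theta ^ (CARD('a) ^ m)))"
    by (rule sum.mono_neutral_right) (auto simp: N_def poly_newton_poly_eq_0)
  finally show ?thesis .
qed

lemma newton_coeff_0: "newton_coeff 0 = P"
  using power_expansion[of 0] by (simp add: newton_poly_def)

text \<open>
  For \<open>k < d\<close>, evaluate at the node \<open>\<theta>\<^bsup>q^k\<^esup>\<close>: the value of \<open>P(T)\<close> there is a power of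
  \<open>P\<close>, and the value \<open>D\<^sub>k\<close> of \<open>b\<^sub>k\<close> is prime to \<open>P\<close>.
\<close>

lemma dvd_newton_coeff: "k \<noteq> d \<Longrightarrow> P dvd newton_coeff k"
proof (induction k rule: less_induct)
  case (less k)
  show ?case
  proof (cases "k < d")
    case True
    have sum: "P ^ (CARD('a) ^ k) = (\<Sum>i<k. newton_coeff i * poly (newton_poly i) (theta ^ (CARD('a) ^ k)))
        + newton_coeff k * carlitz_D k"
      using carlitz_D_newton_poly[of k k, where 'a = 'a]
      unfolding power_expansion by (simp add: lessThan_Suc_atMost[symmetric])
    moreover have "P dvd P ^ (CARD('a) ^ k)" by (intro dvd_power) simp
    moreover have "P dvd (\<Sum>i<k. newton_coeff i * poly (newton_poly i) (theta ^ (CARD('a) ^ k)))"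
      using True less.IH by (intro dvd_sum dvd_mult2) auto
    ultimately have "P dvd newton_coeff k * carlitz_D k"
      unfolding sum by (simp only: dvd_add_right_iff)
    thus ?thesis
      using not_dvd_carlitz_D[OF True] prime by (auto dest: prime_elem_dvd_multD)
  qed (use less.prems newton_coeff(3)[of k] in auto)
qed

text \<open>
  In coefficients, this is the functional equation of \<open>exp\<^sub>C\<close>: it takes multiplication by \<open>P\<close>
  to \<open>C\<^sub>P\<close>.
\<close>

lemma newton_coeff_carlitz_D:
  "(\<Sum>k\<le>m. to_fract (newton_coeff k) * (1 / to_fract (carlitz_D (m - k))) ^ (CARD('a) ^ k))
    = to_fract P ^ (CARD('a) ^ m) / to_fract (carlitz_D m)"
proof -
  have "to_fract (newton_coeff k) * (1 / to_fract (carlitz_D (m - k))) ^ (CARD('a) ^ k)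
      = to_fract (newton_coeff k * poly (newton_poly k) (theta ^ (CARD('a) ^ m))) / to_fract (carlitz_D m)"
    if "k \<le> m" for k
  proof -
    have D: "to_fract (carlitz_D m) = to_fract (poly (newton_poly k) (theta ^ (CARD('a) ^ m)))
        * to_fract (carlitz_D (m - k) :: 'a poly) ^ (CARD('a) ^ k)"
      by (subst carlitz_D_newton_poly[OF that]) (simp add: to_fract_power)
    moreover have "to_fract (carlitz_D m :: 'a poly) \<noteq> 0" by (simp add: carlitz_D_nz)
    ultimately have "to_fract (poly (newton_poly k) (theta ^ (CARD('a) ^ m) :: 'a poly)) \<noteq> 0" by auto
    thus ?thesis by (simp add: D power_divide)
  qed
  thus ?thesis
    unfolding to_fract_power[symmetric] power_expansion to_fract_sum sum_divide_distrib
    by (intro sum.cong) auto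
qed

text \<open>
  Modulo \<open>P\<close> only the leading term of the Newton expansion of \<open>P(T)\<close> survives.
\<close>

lemma newton_prod_congruent:
  "newton_prod d - (\<Prod>v\<in>UNIV. at_var P v) \<in> coeffs_in local_ideal"
  unfolding newton_prod_def
proof (rule prod_congruent)
  fix v :: 'b
  have "lift_coeffs P = newton_poly d + (\<Sum>k<d. smult (newton_coeff k) (newton_poly k))"
    using newton_coeff(1)[of d] by (simp add: lessThan_Suc_atMost[symmetric] newton_coeff(2))
  hence "eval_A (newton_poly d) (mvar v) - at_var P v
      = - (\<Sum>k<d. mconst (to_fract (newton_coeff k)) * eval_A (newton_poly k) (mvar v))"
    by (simp add: at_var_eq eval_A_add eval_A_sum eval_A_smult)
  moreover have "0 - (\<Sum>k<d. mconst (to_fract (newton_coeff k)) * eval_A (newton_poly k) (mvar v))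
      \<in> coeffs_in local_ideal"
    by (intro coeffs_ideal_diff coeffs_ideal_sum coeffs_ideal_mult integral_eval_A
        coeffs_in_mconst ideal_0 to_fract_ideal dvd_newton_coeff)
      (auto simp: coeffs_in_def ideal_0)
  ultimately show "eval_A (newton_poly d) (mvar v) - at_var P v \<in> coeffs_in local_ideal" by simp
qed (auto simp: at_var_eq integral_eval_A)

text \<open>
  The right side is the coefficient of \<open>z\<^sup>n\<close> in \<open>exp\<^sub>z(P L(1,s,z))\<close>, the left side that of
  \<open>\<Sum> c\<^sub>k \<tau>\<^sub>z\<^sup>k\<close> applied to \<open>exp\<^sub>z(L(1,s,z))\<close>.
\<close>

lemma carlitz_P_sigma:
  "(\<Sum>k\<le>n. mconst (to_fract (newton_coeff k)) * newton_prod k * coeff_frob k (fps_nth sigma (n - k)))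
   = (\<Sum>m\<le>n. mconst (to_fract P ^ (CARD('a) ^ m) / to_fract (carlitz_D m)) * newton_prod m
       * coeff_frob m (power_sum (n - m)))"
proof -
  define D where "D i = 1 / to_fract (carlitz_D i :: 'a poly)" for i
  have "(\<Sum>k\<le>n. mconst (to_fract (newton_coeff k)) * newton_prod k * coeff_frob k (fps_nth sigma (n - k)))
     = (\<Sum>k\<le>n. \<Sum>j\<le>n - k. mconst (to_fract (newton_coeff k)) * newton_prod k *
          coeff_frob k (mconst (D j) * newton_prod j * coeff_frob j (power_sum (n - k - j))))"
    unfolding sigma_nth coeff_frob_sum sum_distrib_left D_def ..
  also have "\<dots> = (\<Sum>k\<le>n. \<Sum>j\<le>n - k. mconst (to_fract (newton_coeff k) * D j ^ (CARD('a) ^ k)) *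
      (newton_prod (k + j) * coeff_frob (k + j) (power_sum (n - (k + j)))))"
    by (intro sum.cong refl)
      (simp add: coeff_frob_mult coeff_frob_mconst coeff_frob_coeff_frob newton_prod_add mconst_mult algebra_simps)
  also have "\<dots> = (\<Sum>m\<le>n. \<Sum>k\<le>m. mconst (to_fract (newton_coeff k) * D (m - k) ^ (CARD('a) ^ k)) *
      (newton_prod m * coeff_frob m (power_sum (n - m))))"
    by (subst sum_triangle) simp
  also have "\<dots> = (\<Sum>m\<le>n. mconst (\<Sum>k\<le>m. to_fract (newton_coeff k) * D (m - k) ^ (CARD('a) ^ k)) *
      (newton_prod m * coeff_frob m (power_sum (n - m))))"
    by (simp add: mconst_sum sum_distrib_right)
  finally show ?thesis
    by (simp add: D_def newton_coeff_carlitz_D mult.assoc)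
qed

definition coprime_power_sum :: "nat \<Rightarrow> ('n::finite, 'a) mpol" where
  "coprime_power_sum n = (\<Sum>a\<in>{a\<in>monic_deg n. \<not> P dvd a}. mconst (1 / to_fract a) * (\<Prod>v\<in>UNIV. at_var a v))"

lemma monic_multiples:
  "{a\<in>monic_deg n. P dvd a} = (if d \<le> n then (*) P ` monic_deg (n - d) else {})"
proof -
  have P0: "P \<noteq> 0" using prime by auto
  have mult: "P * b \<in> monic_deg n \<longleftrightarrow> d \<le> n \<and> b \<in> monic_deg (n - d)" for b
  proof (cases "b = 0")
    case False
    thus ?thesis using P0
      unfolding monic_deg_def mem_Collect_eq lead_coeff_mult monic by (auto simp: degree_mult_eq)
  qed (simp add: monic_deg_def)
  show ?thesis by (auto simp: mult elim!: dvdE)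
qed

text \<open>
  The Euler factor at \<open>P\<close>: the monic multiples of \<open>P\<close> are the products of \<open>P\<close> with the monic
  polynomials of degree \<open>n - d\<close>.
\<close>

lemma power_sum_split:
  "power_sum n = coprime_power_sum n + (if d \<le> n
     then mconst (1 / to_fract P) * ((\<Prod>v\<in>UNIV. at_var P v) * power_sum (n - d)) else 0)"
proof -
  define g :: "'a poly \<Rightarrow> ('b, 'a) mpol" where "g a = mconst (1 / to_fract a) * (\<Prod>v\<in>UNIV. at_var a v)" for a
  have g: "g (P * b) = mconst (1 / to_fract P) * (\<Prod>v\<in>UNIV. at_var P v) * g b" for b
  proof -
    have "(mconst (1 / to_fract (P * b)) :: ('b, 'a) mpol)
      = mconst (1 / to_fract P) * mconst (1 / to_fract b)"
      by (simp flip: mconst_mult)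
    thus ?thesis unfolding g_def at_var_mult prod.distrib by (simp only: mult_ac)
  qed
  have inj: "inj_on ((*) P) M" for M
    using prime by (auto intro!: inj_onI)
  have "power_sum n = (\<Sum>a\<in>monic_deg n. g a)" by (simp add: power_sum_def g_def)
  also have "monic_deg n = {a\<in>monic_deg n. \<not> P dvd a} \<union> {a\<in>monic_deg n. P dvd a}" by auto
  also have "(\<Sum>a\<in>\<dots>. g a) = coprime_power_sum n + (\<Sum>a\<in>{a\<in>monic_deg n. P dvd a}. g a)"
    unfolding coprime_power_sum_def g_def[symmetric]
    by (rule sum.union_disjoint) (auto simp: finite_monic_deg)
  also have "(\<Sum>a\<in>{a\<in>monic_deg n. P dvd a}. g a) = (if d \<le> n
     then mconst (1 / to_fract P) * ((\<Prod>v\<in>UNIV. at_var P v) * power_sum (n - d)) else 0)"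
    unfolding monic_multiples
    by (simp add: sum.reindex[OF inj] g sum_distrib_left[symmetric] mult.assoc)
      (simp add: power_sum_def g_def)
  finally show ?thesis .
qed

text \<open>
  The coefficient of \<open>z\<^sup>n\<close> in \<open>exp\<^sub>z(P L')\<close>, where \<open>L'\<close> is the part of \<open>L(1,s,z)\<close> with
  \<open>a\<close> prime to \<open>P\<close>.
\<close>

definition euler_error :: "nat \<Rightarrow> ('n::finite, 'a) mpol" where
  "euler_error n = (\<Sum>m\<le>n. mconst (to_fract P ^ (CARD('a) ^ m) / to_fract (carlitz_D m)) * newton_prod m
       * coeff_frob m (coprime_power_sum (n - m)))"

lemma euler_error: "euler_error n \<in> coeffs_in local_ideal"
proof -
  have "coprime_power_sum k \<in> coeffs_in local_ring" for k
    unfolding coprime_power_sum_def at_var_eq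
    using local_ringI[of _ 1]
    by (intro integral_sum integral_mult integral_prod integral_eval_A coeffs_in_mconst local_0) auto
  thus ?thesis
    unfolding euler_error_def
    by (intro coeffs_ideal_sum coeffs_ideal_mult integral_newton_prod integral_coeff_frob
        coeffs_in_mconst ideal_0 power_over_carlitz_D)
qed

text \<open>
  The multiples of \<open>P\<close> contribute \<open>exp\<^sub>z\<close> of \<open>z\<^sup>d P(t\<^sub>1) \<cdots> P(t\<^sub>s) L(1,s,z)\<close>, and the factor
  in front of \<open>L(1,s,z)\<close> is fixed by \<open>\<phi>\<close>, hence comes out of \<open>exp\<^sub>z\<close>.
\<close>

lemma carlitz_P_sigma_eq:
  "(\<Sum>k\<le>n. mconst (to_fract (newton_coeff k)) * newton_prod k * coeff_frob k (fps_nth sigma (n - k)))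
   = euler_error n + (if d \<le> n then (\<Prod>v\<in>UNIV. at_var P v) * fps_nth sigma (n - d) else 0)"
proof -
  define PP :: "('b, 'a) mpol" where "PP = (\<Prod>v\<in>UNIV. at_var P v)"
  define D where "D i = 1 / to_fract (carlitz_D i :: 'a poly)" for i
  have P0: "to_fract P \<noteq> 0" using prime by auto
  have PP: "coeff_frob m PP = PP" for m by (simp add: PP_def coeff_frob_prod coeff_frob_at_var)
  have "mconst (to_fract P ^ (CARD('a) ^ m) / to_fract (carlitz_D m)) * newton_prod m
    * coeff_frob m (power_sum (n - m))
      = mconst (to_fract P ^ (CARD('a) ^ m) / to_fract (carlitz_D m)) * newton_prod m
        * coeff_frob m (coprime_power_sum (n - m))
        + (if m + d \<le> n then PP * (mconst (D m) * newton_prod m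
          * coeff_frob m (power_sum (n - d - m))) else 0)"
    if "m \<le> n" for m
  proof (cases "m + d \<le> n")
    case True
    define A where "A = (mconst (to_fract P ^ (CARD('a) ^ m) / to_fract (carlitz_D m)) :: ('b, 'a) mpol)"
    define B where "B = (mconst ((1 / to_fract P) ^ (CARD('a) ^ m)) :: ('b, 'a) mpol)"
    have AB: "A * B = mconst (D m)"
      using P0 by (simp add: A_def B_def D_def power_divide flip: mconst_mult)
    have "d \<le> n - m" "n - m - d = n - d - m" using True by auto
    hence "coeff_frob m (power_sum (n - m))
      = coeff_frob m (coprime_power_sum (n - m)) + B * (PP * coeff_frob m (power_sum (n - d - m)))"
      by (subst power_sum_split)
        (simp add: PP_def[symmetric] coeff_frob_add coeff_frob_mult coeff_frob_mconst PP B_def)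
    hence "A * newton_prod m * coeff_frob m (power_sum (n - m))
      = A * newton_prod m * coeff_frob m (coprime_power_sum (n - m))
        + PP * ((A * B) * newton_prod m * coeff_frob m (power_sum (n - d - m)))"
      by (simp only: distrib_left mult_ac)
    thus ?thesis using True unfolding AB by (simp add: A_def)
  next
    case False
    hence "\<not> d \<le> n - m" using that by simp
    thus ?thesis using False by (subst power_sum_split) simp
  qed
  hence "(\<Sum>k\<le>n. mconst (to_fract (newton_coeff k)) * newton_prod k * coeff_frob k (fps_nth sigma (n - k)))
    = euler_error n + (\<Sum>m\<le>n. if m + d \<le> n then PP * (mconst (D m) * newton_prod m
      * coeff_frob m (power_sum (n - d - m))) else 0)"
    unfolding carlitz_P_sigma euler_error_def sum.distrib[symmetric] by (intro sum.cong) auto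
  also have "(\<Sum>m\<le>n. if m + d \<le> n then PP * (mconst (D m) * newton_prod m
    * coeff_frob m (power_sum (n - d - m))) else 0)
    = (if d \<le> n then PP * fps_nth sigma (n - d) else 0)"
  proof (cases "d \<le> n")
    case True
    hence "(\<Sum>m\<le>n. if m + d \<le> n then PP * (mconst (D m) * newton_prod m
      * coeff_frob m (power_sum (n - d - m))) else 0)
        = (\<Sum>m\<le>n - d. PP * (mconst (D m) * newton_prod m * coeff_frob m (power_sum (n - d - m))))"
      by (intro sum.mono_neutral_cong_right) auto
    thus ?thesis using True by (simp add: sigma_nth D_def sum_distrib_left)
  qed (auto intro!: sum.neutral)
  finally show ?thesis by (simp add: PP_def)
qed

text \<open>
  In \<open>carlitz_P_sigma_eq\<close> the term \<open>k = 0\<close> is \<open>P \<sigma>\<^sub>s\<^sub>,\<^sub>n\<close>.  All other terms are divisible by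
  \<open>P\<close> once the earlier coefficients are \<open>P\<close>-integral: the term \<open>k = d\<close> together with the term
  \<open>P(t\<^sub>1) \<cdots> P(t\<^sub>s) \<sigma>\<^sub>s\<^sub>,\<^sub>n\<^sub>-\<^sub>d\<close>, and each of the remaining ones separately.
\<close>

lemma sigma_integral: "fps_nth (sigma :: ('n::finite, 'a) mpol fps) n \<in> coeffs_in local_ring"
proof (induction n rule: less_induct)
  case (less n)
  define \<sigma> :: "nat \<Rightarrow> ('n, 'a) mpol" where "\<sigma> = fps_nth sigma"
  define T where "T k = mconst (to_fract (newton_coeff k)) * newton_prod k * coeff_frob k (\<sigma> (n - k))" for k
  define PP :: "('n, 'a) mpol" where "PP = (\<Prod>v\<in>UNIV. at_var P v)"
  have IH: "\<sigma> m \<in> coeffs_in local_ring" if "m < n" for m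
    using less that by (simp add: \<sigma>_def)
  define B where "B = (if d \<le> n then T d - PP * \<sigma> (n - d) else 0)"
  have "B \<in> coeffs_in local_ideal"
  proof (cases "d \<le> n")
    case True
    hence s: "\<sigma> (n - d) \<in> coeffs_in local_ring" using degree_pos by (intro IH) simp
    have "B = (coeff_frob d (\<sigma> (n - d)) - \<sigma> (n - d)) * newton_prod d + (newton_prod d - PP) * \<sigma> (n - d)"
      using True by (simp add: B_def T_def newton_coeff(2) algebra_simps)
    also have "\<dots> \<in> coeffs_in local_ideal"
      unfolding PP_def
      by (intro coeffs_ideal_add coeffs_ideal_mult coeff_frob_fermat s integral_newton_prod newton_prod_congruent)
    finally show ?thesis .
  qed (simp add: B_def coeffs_in_def ideal_0)
  moreover have "(\<Sum>k\<in>{1..n} - {d}. T k) \<in> coeffs_in local_ideal"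
    unfolding T_def
    by (intro coeffs_ideal_sum coeffs_ideal_mult coeffs_in_mconst ideal_0 to_fract_ideal
        dvd_newton_coeff integral_newton_prod integral_coeff_frob IH) auto
  moreover have "mconst (to_fract P) * \<sigma> n = euler_error n - (\<Sum>k\<in>{1..n} - {d}. T k) - B"
  proof -
    have "(\<Sum>k\<le>n. T k) = T 0 + (\<Sum>k\<in>{1..n}. T k)"
      by (simp add: atMost_atLeast0 sum.atLeast_Suc_atMost)
    also have "(\<Sum>k\<in>{1..n}. T k) = (\<Sum>k\<in>{1..n} - {d}. T k) + (if d \<le> n then T d else 0)"
      using degree_pos by (cases "d \<le> n") (auto simp: sum.remove[of _ d] add.commute intro!: sum.cong)
    also have "T 0 = mconst (to_fract P) * \<sigma> n" by (simp add: T_def newton_coeff_0)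
    also have "(\<Sum>k\<le>n. T k) = euler_error n + (if d \<le> n then PP * \<sigma> (n - d) else 0)"
      unfolding T_def \<sigma>_def PP_def by (rule carlitz_P_sigma_eq)
    finally show ?thesis by (auto simp: B_def algebra_simps)
  qed
  ultimately have "mconst (to_fract P) * \<sigma> n \<in> coeffs_in local_ideal"
    by (simp add: coeffs_ideal_diff euler_error)
  thus ?case by (simp add: coeffs_in_def lookup_mconst_mult ideal_cancel \<sigma>_def)
qed

end

section \<open>Degree at infinity\<close>

text \<open>
  Degrees are in \<open>\<theta>\<close>, so the bound is on the absolute value at infinity.  The numerator \<open>0\<close> is
  admitted separately because its degree is \<open>0\<close> by convention.
\<close>

definition deg_le :: "int \<Rightarrow> 'a::finite_field poly fract set" where
  "deg_le e = {to_fract a / to_fract b | a b. b \<noteq> 0 \<and> (a = 0 \<or> int (degree a) \<le> int (degree b) + e)}"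

lemma deg_leI:
  "x = to_fract a / to_fract b \<Longrightarrow> b \<noteq> 0 \<Longrightarrow> (a \<noteq> 0 \<Longrightarrow> int (degree a) \<le> int (degree b) + e) \<Longrightarrow> x \<in> deg_le e"
  unfolding deg_le_def by blast

lemma deg_leE:
  assumes "x \<in> deg_le e"
  obtains a b where "x = to_fract a / to_fract b" "b \<noteq> 0" "a = 0 \<or> int (degree a) \<le> int (degree b) + e"
  using assms unfolding deg_le_def by blast

lemma deg_le_0: "0 \<in> deg_le e"
  by (rule deg_leI[of _ 0 1]) simp_all

lemma to_fract_deg_le: "int (degree a) \<le> e \<Longrightarrow> to_fract a \<in> deg_le e"
  by (rule deg_leI[of _ a 1]) simp_all

lemma inverse_deg_le: "b \<noteq> 0 \<Longrightarrow> 1 / to_fract b \<in> deg_le (- int (degree b))"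
  by (rule deg_leI[of _ 1 b]) simp_all

lemma deg_le_mono: "x \<in> deg_le e \<Longrightarrow> e \<le> e' \<Longrightarrow> x \<in> deg_le e'"
  by (elim deg_leE, rule deg_leI) auto

lemma deg_le_add: "x \<in> deg_le e \<Longrightarrow> y \<in> deg_le e \<Longrightarrow> x + y \<in> deg_le e"
proof (elim deg_leE)
  fix a b a' b'
  assume *: "x = to_fract a / to_fract b" "b \<noteq> 0" "a = 0 \<or> int (degree a) \<le> int (degree b) + e"
    "y = to_fract a' / to_fract b'" "b' \<noteq> 0" "a' = 0 \<or> int (degree a') \<le> int (degree b') + e"
  show ?thesis
  proof (rule deg_leI)
    show "x + y = to_fract (a * b' + a' * b) / to_fract (b * b')"
      using * by (simp add: field_simps)
    show "b * b' \<noteq> 0" using * by simp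
    assume nz: "a * b' + a' * b \<noteq> 0"
    have 1: "a * b' = 0 \<or> int (degree (a * b')) \<le> int (degree (b * b')) + e"
      using * by (cases "a = 0") (auto simp: degree_mult_eq)
    have 2: "a' * b = 0 \<or> int (degree (a' * b)) \<le> int (degree (b * b')) + e"
      using * by (cases "a' = 0") (auto simp: degree_mult_eq)
    show "int (degree (a * b' + a' * b)) \<le> int (degree (b * b')) + e"
      using nz 1 2 degree_add_le_max[of "a * b'" "a' * b"] by auto
  qed
qed

lemma deg_le_mult: "x \<in> deg_le e \<Longrightarrow> y \<in> deg_le e' \<Longrightarrow> x * y \<in> deg_le (e + e')"
proof (elim deg_leE)
  fix a b a' b'
  assume *: "x = to_fract a / to_fract b" "b \<noteq> 0" "a = 0 \<or> int (degree a) \<le> int (degree b) + e"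
    "y = to_fract a' / to_fract b'" "b' \<noteq> 0" "a' = 0 \<or> int (degree a') \<le> int (degree b') + e'"
  show ?thesis
    by (rule deg_leI[of _ "a * a'" "b * b'"]) (use * in \<open>auto simp: degree_mult_eq\<close>)
qed

lemma deg_le_power: "x \<in> deg_le e \<Longrightarrow> x ^ n \<in> deg_le (int n * e)"
proof (induction n)
  case 0
  show ?case using to_fract_deg_le[of 1 0] by simp
next
  case (Suc n)
  thus ?case using deg_le_mult[of x e "x ^ n" "int n * e"] by (simp add: algebra_simps)
qed

lemma deg_le_uminus: "x \<in> deg_le e \<Longrightarrow> - x \<in> deg_le e"
  using deg_le_mult[of "-1" 0 x e] to_fract_deg_le[of "-1" 0] by simp

lemma to_fract_deg_le_neg: "to_fract a \<in> deg_le e \<Longrightarrow> e < 0 \<Longrightarrow> a = 0"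
proof (elim deg_leE)
  fix c b
  assume *: "to_fract a = to_fract c / to_fract b" "b \<noteq> 0" "c = 0 \<or> int (degree c) \<le> int (degree b) + e" "e < 0"
  hence "to_fract (a * b) = to_fract c" by (simp add: field_simps)
  hence c: "c = a * b" by (simp only: to_fract_eq_iff)
  show "a = 0"
  proof (rule ccontr)
    assume "a \<noteq> 0"
    thus False using * by (auto simp: c degree_mult_eq)
  qed
qed

lemmas coeffs_deg_sum = coeffs_in_sum[OF deg_le_0 deg_le_add]

lemma coeffs_deg_mono: "F \<in> coeffs_in (deg_le e) \<Longrightarrow> e \<le> e' \<Longrightarrow> F \<in> coeffs_in (deg_le e')"
  by (auto simp: coeffs_in_def intro: deg_le_mono)

lemma coeffs_deg_mult:
  "F \<in> coeffs_in (deg_le e) \<Longrightarrow> G \<in> coeffs_in (deg_le e') \<Longrightarrow> F * G \<in> coeffs_in (deg_le (e + e'))"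
  by (erule coeffs_in_mult) (auto intro: deg_le_0 deg_le_add deg_le_mult)

lemma coeffs_deg_diff:
  assumes "F \<in> coeffs_in (deg_le e)" "G \<in> coeffs_in (deg_le e)"
  shows "F - G \<in> coeffs_in (deg_le e)"
  unfolding coeffs_in_def
proof safe
  fix m
  have "Poly_Mapping.lookup F m \<in> deg_le e" "- Poly_Mapping.lookup G m \<in> deg_le e"
    using assms by (auto simp: coeffs_in_def intro: deg_le_uminus)
  from deg_le_add[OF this] show "Poly_Mapping.lookup (F - G) m \<in> deg_le e"
    by (simp add: lookup_minus)
qed

lemma coeffs_deg_1: "1 \<in> coeffs_in (deg_le 0)"
  using coeffs_in_mconst[OF deg_le_0 to_fract_deg_le[of 1 0]] by simp

lemma coeffs_deg_prod:
  "(\<And>i. i \<in> I \<Longrightarrow> F i \<in> coeffs_in (deg_le (e i))) \<Longrightarrow> prod F I \<in> coeffs_in (deg_le (\<Sum>i\<in>I. e i))"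
  by (induction I rule: infinite_finite_induct) (simp_all add: coeffs_deg_1 coeffs_deg_mult)

lemma coeffs_deg_mvar: "0 \<le> e \<Longrightarrow> mvar v \<in> coeffs_in (deg_le e)"
  using to_fract_deg_le[of 1 e] by (intro coeffs_in_mvar deg_le_0) simp

lemma coeffs_deg_coeff_frob:
  fixes F :: "('n, 'a::finite_field) mpol"
  shows "F \<in> coeffs_in (deg_le e) \<Longrightarrow> coeff_frob j F \<in> coeffs_in (deg_le (int (CARD('a) ^ j) * e))"
  unfolding coeffs_in_def lookup_coeff_frob mem_Collect_eq by (intro allI deg_le_power) (rule spec)

lemma coeffs_deg_at_var: "at_var a v \<in> coeffs_in (deg_le 0)"
  unfolding at_var_eq
proof (induction a)
  case 0
  show ?case by (simp add: coeffs_in_def deg_le_0)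
next
  case (pCons c a)
  have "mvar v * eval_A (lift_coeffs a) (mvar v) \<in> coeffs_in (deg_le (0 + 0))"
    by (intro coeffs_deg_mult coeffs_deg_mvar pCons.IH) simp
  moreover have "mconst (to_fract [:c:]) \<in> coeffs_in (deg_le 0)"
    by (intro coeffs_in_mconst deg_le_0 to_fract_deg_le) simp
  ultimately show ?case
    unfolding lift_coeffs_pCons eval_A_pCons by (intro coeffs_in_add[OF deg_le_add]) simp_all
qed

lemma coeffs_deg_power_sum:
  "(power_sum k :: ('n::finite, 'a::finite_field) mpol) \<in> coeffs_in (deg_le (- int k))"
  unfolding power_sum_def
proof (rule coeffs_deg_sum)
  fix a :: "'a poly"
  assume "a \<in> monic_deg k"
  hence a: "a \<noteq> 0" "degree a = k" by (auto simp: monic_deg_def)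
  have "(\<Prod>j\<in>UNIV. at_var a (j :: 'n)) \<in> coeffs_in (deg_le 0)"
    using coeffs_deg_prod[of UNIV "at_var a" "\<lambda>_. 0"] by (simp add: coeffs_deg_at_var)
  hence "mconst (1 / to_fract a) * (\<Prod>j\<in>(UNIV::'n set). at_var a j) \<in> coeffs_in (deg_le (- int k + 0))"
    by (intro coeffs_deg_mult coeffs_in_mconst deg_le_0)
      (use inverse_deg_le[of a] a in simp_all)
  thus "mconst (1 / to_fract a) * (\<Prod>j\<in>(UNIV::'n set). at_var a j) \<in> coeffs_in (deg_le (- int k))" by simp
qed

lemma coeffs_deg_newton_prod:
  "(newton_prod j :: ('n::finite, 'a::finite_field) mpol)
    \<in> coeffs_in (deg_le (int CARD('n) * (\<Sum>k<j. int (CARD('a) ^ k))))"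
proof -
  have "(newton_prod j :: ('n, 'a) mpol) \<in> coeffs_in (deg_le (\<Sum>v\<in>(UNIV::'n set). \<Sum>k<j. int (CARD('a) ^ k)))"
    unfolding newton_prod_def eval_A_newton_poly
    by (intro coeffs_deg_prod coeffs_deg_diff coeffs_deg_mvar coeffs_in_mconst deg_le_0)
      (auto simp: theta_def degree_power_eq simp flip: to_fract_power intro!: to_fract_deg_le)
  thus ?thesis by simp
qed

lemma degree_carlitz_D: "degree (carlitz_D j :: 'a::finite_field poly) = j * CARD('a) ^ j"
proof (induction j)
  case (Suc j)
  have q: "1 < CARD('a) ^ Suc j" using card_ge_2[where 'a = 'a] by (intro one_less_power) auto
  define X :: "'a poly" where "X = theta ^ (CARD('a) ^ Suc j) - theta"
  have "degree X = CARD('a) ^ Suc j"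
    unfolding X_def
    using q degree_add_eq_left[of "- theta" "theta ^ (CARD('a) ^ Suc j) :: 'a poly",
        unfolded add_uminus_conv_diff]
    by (simp add: theta_def degree_power_eq)
  moreover have "X \<noteq> 0"
    using theta_power_neq_theta[of "Suc j", where 'a = 'a] by (simp add: X_def)
  moreover have "carlitz_D (Suc j) = X * carlitz_D j ^ CARD('a)"
    by (simp add: X_def)
  ultimately show ?case
    using Suc carlitz_D_nz[of j, where 'a = 'a] by (simp add: degree_mult_eq degree_power_eq)
qed simp

lemma sum_powers_less: "(\<Sum>k<j. int (CARD('a::finite_field) ^ k)) + 1 \<le> int (CARD('a) ^ j)"
proof (induction j)
  case (Suc j)
  have "2 * int (CARD('a) ^ j) \<le> int (CARD('a) ^ Suc j)"
    unfolding power_Suc of_nat_mult using card_ge_2[where 'a = 'a] by (intro mult_right_mono) auto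
  thus ?case using Suc unfolding sum.lessThan_Suc by linarith
qed simp

text \<open>
  The bounds of the factors add up to \<open>s (1 + q + \<cdots> + q\<^bsup>j-1\<^esup>) - n q\<^sup>j\<close>: the degree
  \<open>j q\<^sup>j\<close> of \<open>D\<^sub>j\<close> turns the bound \<open>-(n - j) q\<^sup>j\<close> for the power sum into \<open>-n q\<^sup>j\<close>.
\<close>

lemma coeffs_deg_sigma:
  assumes "CARD('n) \<le> n"
  shows "fps_nth (sigma :: ('n::finite, 'a::finite_field) mpol fps) n \<in> coeffs_in (deg_le (-1))"
  unfolding sigma_nth
proof (rule coeffs_deg_sum)
  fix j
  assume "j \<in> {..n}"
  hence j: "j \<le> n" by simp
  define Q where "Q = int (CARD('a) ^ j)"
  define s where "s = int CARD('n)"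
  define S where "S = (\<Sum>k<j. int (CARD('a) ^ k))"
  have "(mconst (1 / to_fract (carlitz_D j)) * newton_prod j
    * coeff_frob j (power_sum (n - j)) :: ('n, 'a) mpol)
     \<in> coeffs_in (deg_le (- int (degree (carlitz_D j :: 'a poly)) + s * S + Q * (- int (n - j)) :: int)) "
    unfolding s_def S_def Q_def
    by (intro coeffs_deg_mult coeffs_in_mconst deg_le_0 inverse_deg_le carlitz_D_nz coeffs_deg_newton_prod
      coeffs_deg_coeff_frob coeffs_deg_power_sum)
  moreover have "- int (degree (carlitz_D j :: 'a poly)) + s * S + Q * (- int (n - j)) \<le> -1"
  proof -
    have "- int (degree (carlitz_D j :: 'a poly)) + s * S + Q * (- int (n - j)) = s * S - int n * Q"
      using j by (simp add: degree_carlitz_D Q_def of_nat_diff algebra_simps)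
    also have "\<dots> \<le> s * (Q - 1) - s * Q"
    proof -
      have "s * S \<le> s * (Q - 1)"
        using sum_powers_less[where 'a = 'a, of j] by (intro mult_left_mono) (auto simp: s_def S_def Q_def)
      moreover have "s * Q \<le> int n * Q" using assms by (intro mult_right_mono) (auto simp: s_def Q_def)
      ultimately show ?thesis by linarith
    qed
    also have "\<dots> = - s" by (simp add: algebra_simps)
    also have "\<dots> \<le> -1" by (simp add: s_def Suc_le_eq)
    finally show ?thesis .
  qed
  ultimately show "(mconst (1 / to_fract (carlitz_D j)) * newton_prod j
    * coeff_frob j (power_sum (n - j)) :: ('n, 'a) mpol)
     \<in> coeffs_in (deg_le (-1))" by (rule coeffs_deg_mono)
qed

section \<open>From local to global\<close>

lemma exists_monic_prime_divisor:
  fixes b :: "'a::finite_field poly"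
  assumes "degree b > 0"
  shows "\<exists>P. monic_prime P \<and> P dvd b"
proof -
  define good where "good p \<longleftrightarrow> p dvd b \<and> degree p > 0" for p
  have "good b" using assms by (simp add: good_def)
  then obtain p where p: "good p" "\<And>r. good r \<Longrightarrow> degree p \<le> degree r"
    using ex_has_least_nat[of good b degree] by blast
  define P where "P = smult (inverse (lead_coeff p)) p"
  have p0: "p \<noteq> 0" using p(1) by (auto simp: good_def)
  hence deg: "degree P = degree p" and lc: "lead_coeff P = 1" and P0: "P \<noteq> 0"
    by (auto simp: P_def)
  have dvd: "P dvd b" using p(1) p0 by (simp add: P_def good_def smult_dvd)
  have "irreducible P"
  proof (rule irreducibleI)
    show "\<not> P dvd 1" using p(1) deg P0 by (simp add: is_unit_iff_degree good_def)
    fix u v assume uv: "P = u * v"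
    hence nz: "u \<noteq> 0" "v \<noteq> 0" using P0 by auto
    hence degs: "degree p = degree u + degree v" using deg by (simp add: uv degree_mult_eq)
    have "u dvd b" using dvd uv dvd_mult_left by blast
    hence "degree u = 0 \<or> degree p \<le> degree u" using p(2)[of u] by (auto simp: good_def)
    thus "u dvd 1 \<or> v dvd 1" using nz degs by (auto simp: is_unit_iff_degree)
  qed (rule P0)
  hence "monic_prime P" using lc by (simp add: monic_prime_def field_poly_irreducible_imp_prime)
  thus ?thesis using dvd by blast
qed

text \<open>
  A prime dividing a denominator of least degree could be cancelled, by integrality at that prime.
\<close>

lemma integral_if_locally_integral:
  fixes x :: "'a::finite_field poly fract"
  assumes "\<And>P. monic_prime P \<Longrightarrow> x \<in> monic_prime.local_ring P"
  shows "x \<in> range to_fract"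
proof -
  define denom where "denom b \<longleftrightarrow> b \<noteq> 0 \<and> (\<exists>a. x * to_fract b = to_fract a)" for b
  have "\<exists>b. denom b"
  proof (cases x)
    case (Fract a b)
    hence "x * to_fract b = to_fract a" by (simp add: to_fract_def eq_fract)
    thus ?thesis using Fract by (auto simp: denom_def)
  qed
  then obtain b where b: "denom b" "\<And>c. denom c \<Longrightarrow> degree b \<le> degree c"
    using ex_has_least_nat[of denom _ degree] by blast
  then obtain a where a: "x * to_fract b = to_fract a" and b0: "b \<noteq> 0" by (auto simp: denom_def)
  have "degree b = 0"
  proof (rule ccontr)
    assume "degree b \<noteq> 0"
    then obtain P where P: "monic_prime P" "P dvd b" using exists_monic_prime_divisor[of b] by auto
    interpret monic_prime P by (rule P)
    obtain a' b' where x: "x = to_fract a' / to_fract b'" "\<not> P dvd b'" "b' \<noteq> 0"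
      using assms[OF P(1)] by (rule local_ringE)
    obtain k where k: "b = P * k" using P(2) by (auto elim: dvdE)
    have "to_fract (a * b') = to_fract (P * (a' * k))" using a x by (simp add: k field_simps)
    hence "a * b' = P * (a' * k)" by (simp only: to_fract_eq_iff)
    hence "P dvd a" using x(2) prime prime_elem_dvd_multD[of P a b'] by auto
    then obtain a2 where a2: "a = P * a2" by (auto elim: dvdE)
    have nz: "P \<noteq> 0" "k \<noteq> 0" using b0 by (auto simp: k)
    hence "x * to_fract k = to_fract a2" using a by (simp add: k a2)
    hence "denom k" using nz by (auto simp: denom_def)
    thus False using b(2)[of k] nz degree_pos by (simp add: k degree_mult_eq)
  qed
  then obtain c where "b = [:c:]" by (auto elim: degree_eq_zeroE)
  hence "b * [:1 / c:] = 1" using b0 by (simp add: one_pCons)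
  hence "x = x * to_fract (b * [:1 / c:])" by simp
  also have "\<dots> = to_fract (a * [:1 / c:])"
    unfolding to_fract_mult mult.assoc[symmetric] a ..
  finally show ?thesis by blast
qed

lemma sigma_in_A_t_z: "(sigma :: ('n::finite, 'a::finite_field) mpol fps) \<in> A_t_z"
proof -
  define \<sigma> :: "nat \<Rightarrow> ('n, 'a) mpol" where "\<sigma> = fps_nth sigma"
  have integral: "Poly_Mapping.lookup (\<sigma> n) m \<in> range to_fract" for n m
    using monic_prime.sigma_integral[of _ n, where 'n = 'n and 'a = 'a]
    by (intro integral_if_locally_integral) (simp add: coeffs_in_def \<sigma>_def)
  have vanish: "\<sigma> n = 0" if "CARD('n) \<le> n" for n
  proof (rule poly_mapping_eqI)
    fix m
    obtain c where c: "Poly_Mapping.lookup (\<sigma> n) m = to_fract c" using integral by blast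
    moreover have "Poly_Mapping.lookup (\<sigma> n) m \<in> deg_le (-1)"
      using coeffs_deg_sigma[OF that, where 'a = 'a] by (simp add: \<sigma>_def coeffs_in_def)
    ultimately show "Poly_Mapping.lookup (\<sigma> n) m = Poly_Mapping.lookup 0 m"
      using to_fract_deg_le_neg[of c "-1"] by simp
  qed
  define g :: "'a poly fract \<Rightarrow> 'a poly" where "g = inv to_fract"
  have inj: "inj (to_fract :: 'a poly \<Rightarrow> _)" by (auto intro: injI)
  have "g (to_fract 0) = 0" unfolding g_def by (rule inv_f_f[OF inj])
  hence g0: "g 0 = 0" by simp
  define G where "G n = Poly_Mapping.map g (\<sigma> n)" for n
  have G: "Poly_Mapping.map to_fract (G n) = \<sigma> n" for n
  proof (rule poly_mapping_eqI)
    fix m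
    have "to_fract (g (Poly_Mapping.lookup (\<sigma> n) m)) = Poly_Mapping.lookup (\<sigma> n) m"
      unfolding g_def by (rule f_inv_into_f[OF integral])
    thus "Poly_Mapping.lookup (Poly_Mapping.map to_fract (G n)) m = Poly_Mapping.lookup (\<sigma> n) m"
      by (auto simp: G_def Poly_Mapping.map.rep_eq when_def g0)
  qed
  define Q where "Q = (\<Sum>n<CARD('n). monom (G n) n)"
  have "coeff Q n = (if n < CARD('n) then G n else 0)" for n
    by (simp add: Q_def coeff_sum)
  moreover have "Poly_Mapping.map to_fract 0 = (0 :: ('n, 'a) mpol)"
    by (intro poly_mapping_eqI) (simp add: Poly_Mapping.map.rep_eq)
  ultimately have "fps_of_poly (map_poly (Poly_Mapping.map to_fract) Q) = sigma"
    by (intro fps_ext) (auto simp: coeff_map_poly G vanish \<sigma>_def[symmetric])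
  thus ?thesis unfolding A_t_z_def by (rule range_eqI[of _ _ Q, OF sym])
qed

theorem proposition5p4:
  shows "(L_series :: ('n::finite, 'a::finite_field) mpol fps) = log_z sigma
    \<and> (act (L_series :: ('n, 'a) mpol fps) XZ = l_series
       \<and> (l_series :: ('n, 'a) mpol fps) = log_C SS)
    \<and> (act (sigma :: ('n, 'a) mpol fps) XZ = SS
       \<and> (sigma :: ('n, 'a) mpol fps) \<in> A_t_z)"
proof (intro conjI)
  show log: "(L_series :: ('n, 'a) mpol fps) = log_z sigma"
    by (simp add: sigma_def log_z_exp_z)
  show act_sigma: "act (sigma :: ('n, 'a) mpol fps) XZ = SS"
    by (simp add: sigma_def SS_def act_exp_z act_L_series)
  show "act (L_series :: ('n, 'a) mpol fps) XZ = l_series"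
    by (rule act_L_series)
  show "(l_series :: ('n, 'a) mpol fps) = log_C SS"
    by (metis act_L_series act_log_z act_sigma log)
  show "(sigma :: ('n, 'a) mpol fps) \<in> A_t_z"
    by (rule sigma_in_A_t_z)
qed

end
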